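(* For a matroid $M$, the number of cocircuits of size $s$, the number of circuits of size $s$, and the number of cyclic sets (that is, unions of circuits) of size $s$ and rank $j$ are derivable from the catenary data of $M$. In particular, one can deduce whether the matroid has a spanning circuit, so one can determine whether a graph is Hamiltonian from the $\mathcal{G}$-invariant of its cycle matroid.
   Context: For a rank-$r$ matroid $M$ on an $n$-element set $E$: an $(n,r)$-composition is an integer sequence $(a_0,\ldots,a_r)$ with $a_0\ge0$, $a_j>0$ for $1\le j\le r$, and sum $n$. A flag is a chain $X_0\subset X_1\subset\cdots\subset X_r=E$ of flats with $r(X_j)=j$; its composition is $(|X_0|,|X_1-X_0|,\ldots,|X_r-X_{r-1}|)$. $\nu(M;a_0,\ldots,a_r)$ is the number of flags with composition $(a_0,\ldots,a_r)$; the catenary data of $M$ is the vector of these numbers indexed by $(n,r)$-compositions. A quantity is derivable from the catenary data if it is determined by the catenary data. $\mathcal{G}(n,r)$ is the vector space over a field of characteristic zero with basis the formal symbols $[\underline{r}]$, one for each $0,1$-sequence of length $n$ with exactly $r$ ones. For a permutation (linear ordering) $\pi$ of $E$, the rank sequence $\underline{r}(\pi)=r_1\ldots r_n$ has $r_j=r(\{\pi(1),\ldots,\pi(j)\})-r(\{\pi(1),\ldots,\pi(j-1)\})$, and $\mathcal{G}(M)=\sum_\pi[\underline{r}(\pi)]\in\mathcal{G}(n,r)$ over all $n!$ permutations of $E$. The $\mathcal{G}$-invariant and the catenary data of a matroid determine each other. A spanning circuit is a circuit $C$ with $r(C)=r(M)$. A graph is Hamiltonian if it has a cycle passing through every vertex.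 The empty set is a cyclic set (the empty union).
   Formalization: The Hamiltonian claim is proved for graphs in which every vertex lies on a non-loop edge or is the only vertex; without this it fails, since a triangle and a triangle plus an isolated vertex have the same cycle matroid. *)

theory Defs
  imports "HOL-Library.Poly_Mapping" "HOL-Combinatorics.Multiset_Permutations"
begin

section \<open>Matroids\<close>

record 'a indep_system =
  ground :: "'a set"
  indep :: "'a set set"

locale matroid =
  fixes M :: "'a indep_system"
  assumes finite_ground: "finite (ground M)"
    and indep_subset_ground: "I \<in> indep M \<Longrightarrow> I \<subseteq> ground M"
    and empty_indep: "{} \<in> indep M"
    and indep_subset: "I \<in> indep M \<Longrightarrow> J \<subseteq> I \<Longrightarrow> J \<in> indep M"
    and augmentation: "I \<in> indep M \<Longrightarrow> J \<in> indep M \<Longrightarrow> card I < card J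
      \<Longrightarrow> \<exists>x\<in>J - I. insert x I \<in> indep M"

definition rank_of :: "'a indep_system \<Rightarrow> 'a set \<Rightarrow> nat" where
  "rank_of M X = Max (card ` {I \<in> indep M. I \<subseteq> X})"

definition matroid_rank :: "'a indep_system \<Rightarrow> nat" where
  "matroid_rank M = rank_of M (ground M)"

definition basis :: "'a indep_system \<Rightarrow> 'a set \<Rightarrow> bool" where
  "basis M B \<longleftrightarrow> B \<in> indep M \<and> (\<forall>I\<in>indep M. B \<subseteq> I \<longrightarrow> I = B)"

definition dual :: "'a indep_system \<Rightarrow> 'a indep_system" where
  "dual M = \<lparr>ground = ground M,
             indep = {I. I \<subseteq> ground M \<and> (\<exists>B. basis M B \<and> I \<subseteq> ground M - B)}\<rparr>"

definition circuit :: "'a indep_system \<Rightarrow> 'a set \<Rightarrow> bool" where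
  "circuit M C \<longleftrightarrow> C \<subseteq> ground M \<and> C \<notin> indep M \<and> (\<forall>D. D \<subset> C \<longrightarrow> D \<in> indep M)"

definition cocircuit :: "'a indep_system \<Rightarrow> 'a set \<Rightarrow> bool" where
  "cocircuit M C \<longleftrightarrow> circuit (dual M) C"

definition cyclic_set :: "'a indep_system \<Rightarrow> 'a set \<Rightarrow> bool" where
  "cyclic_set M X \<longleftrightarrow> (\<exists>\<C>. (\<forall>C\<in>\<C>. circuit M C) \<and> X = \<Union>\<C>)"

definition spanning_circuit :: "'a indep_system \<Rightarrow> 'a set \<Rightarrow> bool" where
  "spanning_circuit M C \<longleftrightarrow> circuit M C \<and> rank_of M C = matroid_rank M"

definition flat :: "'a indep_system \<Rightarrow> 'a set \<Rightarrow> bool" where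
  "flat M X \<longleftrightarrow> X \<subseteq> ground M \<and> (\<forall>x\<in>ground M - X. rank_of M X < rank_of M (insert x X))"


section \<open>Catenary data\<close>

definition is_composition :: "nat \<Rightarrow> nat \<Rightarrow> nat list \<Rightarrow> bool" where
  "is_composition n r a \<longleftrightarrow>
     length a = r + 1 \<and> (\<forall>j. 1 \<le> j \<and> j \<le> r \<longrightarrow> 0 < a ! j) \<and> sum_list a = n"

definition flag :: "'a indep_system \<Rightarrow> 'a set list \<Rightarrow> bool" where
  "flag M Xs \<longleftrightarrow>
     length Xs = matroid_rank M + 1 \<and>
     (\<forall>j\<le>matroid_rank M. flat M (Xs ! j) \<and> rank_of M (Xs ! j) = j) \<and>
     (\<forall>j<matroid_rank M. Xs ! j \<subset> Xs ! Suc j) \<and>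
     Xs ! matroid_rank M = ground M"

definition flag_composition :: "'a set list \<Rightarrow> nat list" where
  "flag_composition Xs =
     map (\<lambda>j. if j = 0 then card (Xs ! 0) else card (Xs ! j - Xs ! (j - 1))) [0..<length Xs]"

definition flag_count :: "'a indep_system \<Rightarrow> nat list \<Rightarrow> nat" where
  "flag_count M a = card {Xs. flag M Xs \<and> flag_composition Xs = a}"

text \<open>
  The vector of flag counts is a partial map whose domain is its index set, the set of
  \<open>(n, r)\<close>-compositions. Equality of catenary data thus includes equality of \<open>n\<close> and \<open>r\<close>.
\<close>

definition catenary_data :: "'a indep_system \<Rightarrow> nat list \<Rightarrow> nat option" where
  "catenary_data M a =
     (if is_composition (card (ground M)) (matroid_rank M) a then Some (flag_count M a) else None)"


section \<open>The G-invariant\<close>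

definition rank_sequence :: "'a indep_system \<Rightarrow> 'a list \<Rightarrow> nat list" where
  "rank_sequence M xs =
     map (\<lambda>j. rank_of M (set (take (Suc j) xs)) - rank_of M (set (take j xs))) [0..<length xs]"

text \<open>
  All spaces \<open>\<G>(n, r)\<close> are embedded in the free vector space on the finite sequences, with
  \<open>Poly_Mapping.single s 1\<close> as the basis symbol \<open>[s]\<close>; the parameters \<open>n\<close> and \<open>r\<close> can be read
  off from any sequence in the (nonempty) support of the G-invariant.
\<close>

definition G_invariant :: "'a indep_system \<Rightarrow> (nat list \<Rightarrow>\<^sub>0 'k::field_char_0)" where
  "G_invariant M = (\<Sum>xs\<in>permutations_of_set (ground M). Poly_Mapping.single (rank_sequence M xs) 1)"


section \<open>Graphs and their cycle matroids\<close>

record ('v, 'e) pre_multigraph =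
  verts :: "'v set"
  edges :: "'e set"
  ends :: "'e \<Rightarrow> 'v set"

text \<open>Loops are the edges with a single end; parallel edges are allowed.\<close>

locale multigraph =
  fixes G :: "('v, 'e) pre_multigraph"
  assumes finite_verts: "finite (verts G)"
    and finite_edges: "finite (edges G)"
    and ends_subset: "e \<in> edges G \<Longrightarrow> ends G e \<subseteq> verts G"
    and card_ends: "e \<in> edges G \<Longrightarrow> card (ends G e) \<in> {1, 2}"

text \<open>
  The cycle visits \<open>vs\<close> in cyclic order, \<open>es ! i\<close> joining \<open>vs ! i\<close> to its successor.
  A loop is a cycle of length 1 and a pair of parallel edges is a cycle of length 2.
\<close>

definition graph_cycle :: "('v, 'e) pre_multigraph \<Rightarrow> 'v list \<Rightarrow> 'e list \<Rightarrow> bool" where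
  "graph_cycle G vs es \<longleftrightarrow>
     vs \<noteq> [] \<and> length es = length vs \<and> distinct vs \<and> distinct es \<and>
     set vs \<subseteq> verts G \<and> set es \<subseteq> edges G \<and>
     (\<forall>i<length vs. ends G (es ! i) = {vs ! i, vs ! (Suc i mod length vs)})"

definition hamiltonian :: "('v, 'e) pre_multigraph \<Rightarrow> bool" where
  "hamiltonian G \<longleftrightarrow> (\<exists>vs es. graph_cycle G vs es \<and> set vs = verts G)"

definition cycle_matroid :: "('v, 'e) pre_multigraph \<Rightarrow> 'e indep_system" where
  "cycle_matroid G =
     \<lparr>ground = edges G,
      indep = {I. I \<subseteq> edges G \<and> \<not> (\<exists>vs es. graph_cycle G vs es \<and> set es \<subseteq> I)}\<rparr>"

text \<open>
  The cycle matroid does not record vertices incident with no edge, nor where loops are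
  attached: a triangle and a triangle with an additional isolated vertex have the same cycle
  matroid, but only the former is Hamiltonian. The following condition excludes the graphs with
  at least two vertices one of which is incident with no edge other than loops. It holds for all
  connected graphs, and for all loopless (in particular, all simple) graphs without isolated
  vertices.
\<close>

definition no_trivial_component :: "('v, 'e) pre_multigraph \<Rightarrow> bool" where
  "no_trivial_component G \<longleftrightarrow>
     (\<forall>v\<in>verts G. verts G = {v} \<or> (\<exists>e\<in>edges G. v \<in> ends G e \<and> card (ends G e) = 2))"

end

theory Submission
  imports Defs
begin

text \<open>
  Everything is read off the multiset of rank sequences of the permutations, that is, the
  G-invariant. It determines, for all sizes and ranks, the number of pairs \<open>Y \<subseteq> X\<close> of sets of
  the given sizes and ranks, since such a pair is a pair of initial segments of
  \<open>|Y|! |X - Y|! (n - |X|)!\<close> permutations. A set is cyclic iff it has no coloops, and a flat iff it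
  equals its closure; summing \<open>(-1)^|X - Y|\<close> over the pairs where \<open>X - Y\<close> consists of coloops of
  \<open>X\<close>, respectively where \<open>X\<close> lies in the closure of \<open>Y\<close>, counts these sets. Circuits are the
  cyclic sets of nullity one, and cocircuits are the complements of flats of corank one.

  The catenary data determine the rank sequences because each permutation induces a flag, and the
  number of permutations inducing a given flag with a given rank sequence depends only on the
  composition of the flag. Finally, a graph without trivial components is Hamiltonian iff its
  cycle matroid has a spanning circuit.
\<close>

section \<open>Ranks, closures and coloops\<close>

text \<open>Derivability is expressed by comparing two matroids, possibly over different element
  types, that have the same data. So counts are transported rather than computed: each comparison is
  a bijection preserving a statistic, glued from equal fibre sizes by
  \<open>exists_bij_betw_fibers\<close> (nested pairs by type, flags by composition, ground elements
  by level). The two hypotheses of the theorem, equal catenary data and equal G-invariants, both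
  lead to equal multisets of rank sequences. The obstacle is that rank sequences reveal only sizes
  and ranks of segments, while coloops and closures speak of single elements. Since rank rises by at
  most one per element, an extremal rank difference between Y and X controls every element of X - Y:
  the largest possible difference makes them all coloops of X, difference zero puts them all into
  the closure of Y. For fixed X, respectively fixed Y, the admissible pairs form a Boolean lattice,
  whose alternating sum vanishes unless the lattice is a single point.\<close>

lemma exists_bij_betw_fibers:
  fixes f :: "'a \<Rightarrow> 'c" and g :: "'b \<Rightarrow> 'c"
  assumes "finite A" "finite B"
    and eq: "\<And>c. card {x \<in> A. f x = c} = card {y \<in> B. g y = c}"
  shows "\<exists>h. bij_betw h A B \<and> (\<forall>x\<in>A. g (h x) = f x)"
proof -
  have "\<exists>h. bij_betw h {x \<in> A. f x = c} {y \<in> B. g y = c}" for c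
    using assms by (intro finite_same_card_bij) auto
  then obtain h where h: "\<And>c. bij_betw (h c) {x \<in> A. f x = c} {y \<in> B. g y = c}"
    by metis
  \<comment> \<open>Each element is sent by the bijection belonging to its own fibre; images of
    different fibres are disjoint.\<close>
  let ?h = "\<lambda>x. h (f x) x"
  have mem: "?h x \<in> B \<and> g (?h x) = f x" if "x \<in> A" for x
    using bij_betw_apply[OF h[of "f x"], of x] that by auto
  have "inj_on ?h A"
  proof (rule inj_onI)
    fix x y assume xy: "x \<in> A" "y \<in> A" "?h x = ?h y"
    then have "f x = f y" using mem by metis
    then show "x = y" using xy bij_betw_imp_inj_on[OF h[of "f x"]] by (auto dest: inj_onD)
  qed
  moreover have "?h ` A = B"
  proof (intro equalityI subsetI)
    fix y assume "y \<in> B"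
    then have "y \<in> h (g y) ` {x \<in> A. f x = g y}"
      using bij_betw_imp_surj_on[OF h[of "g y"]] by simp
    then obtain x where "x \<in> A" "f x = g y" "y = h (g y) x" by auto
    then show "y \<in> ?h ` A" by (intro image_eqI[of _ _ x]) auto
  qed (use mem in auto)
  ultimately show ?thesis using mem by (auto simp: bij_betw_def)
qed

text \<open>Expand the product of the factors 1 - 1 over \<open>K\<close>. This cancellation is what
  lets the weights detect an empty set of coloops or an empty difference of closure and set.\<close>

lemma sum_Pow_minus_one_power_card:
  assumes "finite K"
  shows "(\<Sum>T\<in>Pow K. (- 1 :: int) ^ card T) = (if K = {} then 1 else 0)"
proof -
  have "(\<Sum>T\<in>Pow K. (- 1 :: int) ^ card T) = (\<Prod>x\<in>K. 1 - 1)"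
    by (subst prod_diff_conv_sum[OF assms]) simp
  then show ?thesis using assms by (auto simp: power_0_left)
qed

context matroid
begin

section \<open>The rank function\<close>

lemma finite_indep: "I \<in> indep M \<Longrightarrow> finite I"
  by (rule finite_subset[OF indep_subset_ground finite_ground])

lemma finite_indep_subsets: "finite {I \<in> indep M. I \<subseteq> X}"
  using finite_subset[of "{I \<in> indep M. I \<subseteq> X}" "Pow (ground M)"] indep_subset_ground finite_ground
  by auto

lemma card_indep_le_rank: "I \<in> indep M \<Longrightarrow> I \<subseteq> X \<Longrightarrow> card I \<le> rank_of M X"
  unfolding rank_of_def using finite_indep_subsets by (intro Max_ge) auto

lemma obtain_rank_witness:
  obtains I where "I \<in> indep M" "I \<subseteq> X" "card I = rank_of M X"
proof -
  have "rank_of M X \<in> card ` {I \<in> indep M. I \<subseteq> X}"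
    unfolding rank_of_def using finite_indep_subsets empty_indep by (intro Max_in) auto
  then show thesis using that by auto
qed

lemma rank_le: "(\<And>I. I \<in> indep M \<Longrightarrow> I \<subseteq> X \<Longrightarrow> card I \<le> k) \<Longrightarrow> rank_of M X \<le> k"
  by (rule obtain_rank_witness[of X]) force

lemma rank_mono: "X \<subseteq> Y \<Longrightarrow> rank_of M X \<le> rank_of M Y"
  by (rule rank_le) (meson card_indep_le_rank subset_trans)

lemma rank_le_insert: "rank_of M X \<le> rank_of M (insert x X)"
  by (rule rank_mono) auto

lemma rank_le_card: "finite X \<Longrightarrow> rank_of M X \<le> card X"
  by (rule rank_le) (simp add: card_mono)

lemma rank_empty [simp]: "rank_of M {} = 0"
  using rank_le_card[of "{}"] by simp

lemma rank_indep: "I \<in> indep M \<Longrightarrow> rank_of M I = card I"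
  by (simp add: card_indep_le_rank finite_indep le_antisym rank_le_card)

lemma indep_iff_rank: "finite X \<Longrightarrow> X \<in> indep M \<longleftrightarrow> rank_of M X = card X"
  by (metis (no_types) card_subset_eq obtain_rank_witness[of X] rank_indep)

lemma rank_insert_le: "rank_of M (insert x X) \<le> Suc (rank_of M X)"
proof (rule rank_le)
  fix I assume I: "I \<in> indep M" "I \<subseteq> insert x X"
  then have "card (I - {x}) \<le> rank_of M X"
    by (intro card_indep_le_rank) (auto intro: indep_subset)
  then show "card I \<le> Suc (rank_of M X)"
    using card_Diff1_le[of I x] finite_indep[OF I(1)] by (cases "x \<in> I") auto
qed

lemma rank_union_le: "finite T \<Longrightarrow> rank_of M (X \<union> T) \<le> rank_of M X + card T"
proof (induction T rule: finite_induct)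
  case (insert x T)
  then show ?case using rank_insert_le[of x "X \<union> T"] by simp
qed simp

lemma extend_to_rank_witness:
  assumes "I \<in> indep M" "I \<subseteq> X"
  obtains J where "J \<in> indep M" "I \<subseteq> J" "J \<subseteq> X" "card J = rank_of M X"
proof -
  have "\<exists>J. J \<in> indep M \<and> I \<subseteq> J \<and> J \<subseteq> X \<and> card J = rank_of M X"
    using assms
  proof (induction "rank_of M X - card I" arbitrary: I)
    case 0
    then show ?case using card_indep_le_rank[of I X] by (intro exI[of _ I]) auto
  next
    case (Suc k)
    obtain K where K: "K \<in> indep M" "K \<subseteq> X" "card K = rank_of M X"
      by (rule obtain_rank_witness)
    have "card I < card K" using Suc.hyps(2) K by linarith
    then obtain x where x: "x \<in> K - I" "insert x I \<in> indep M"
      using augmentation[of I K] Suc.prems K by blast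
    then have "card (insert x I) = Suc (card I)"
      using Suc.prems finite_indep by auto
    then have "k = rank_of M X - card (insert x I)" "insert x I \<subseteq> X"
      using Suc.hyps(2) Suc.prems x K(2) by auto
    then show ?case using Suc.hyps(1)[of "insert x I"] x(2) by blast
  qed
  then show thesis using that by blast
qed

text \<open>A local form of submodularity. Extend a maximal independent set I of X to J in Y and to
  K in \<open>insert x Y\<close>. If the rank grew at the last step, then x lies in K, so
  \<open>insert x I\<close> is independent and the rank would already grow over X.\<close>

lemma rank_insert_eq_mono:
  assumes "X \<subseteq> Y" "rank_of M (insert x X) = rank_of M X"
  shows "rank_of M (insert x Y) = rank_of M Y"
proof (rule ccontr)
  assume "rank_of M (insert x Y) \<noteq> rank_of M Y"
  then have less: "rank_of M Y < rank_of M (insert x Y)"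
    using rank_le_insert[of Y x] by auto
  obtain I where I: "I \<in> indep M" "I \<subseteq> X" "card I = rank_of M X" by (rule obtain_rank_witness)
  obtain J where J: "J \<in> indep M" "I \<subseteq> J" "J \<subseteq> Y" "card J = rank_of M Y"
    using extend_to_rank_witness[of I Y] I assms by auto
  obtain K where K: "K \<in> indep M" "J \<subseteq> K" "K \<subseteq> insert x Y" "card K = rank_of M (insert x Y)"
    using extend_to_rank_witness[of J "insert x Y"] J by auto
  have "\<not> K \<subseteq> Y" using card_indep_le_rank[of K Y] K less by auto
  then have "x \<in> K" "x \<notin> Y" using K by auto
  then have "insert x I \<in> indep M" using indep_subset[OF K(1)] J K by auto
  then have "card (insert x I) \<le> rank_of M (insert x X)"
    using I by (intro card_indep_le_rank) auto
  moreover have "card (insert x I) = Suc (card I)"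
    using \<open>x \<notin> Y\<close> I assms(1) finite_indep[OF I(1)] by (intro card_insert_disjoint) auto
  ultimately show False using assms(2) I by simp
qed

lemma rank_union_eq:
  assumes "finite T" "\<And>x. x \<in> T \<Longrightarrow> rank_of M (insert x X) = rank_of M X"
  shows "rank_of M (X \<union> T) = rank_of M X"
  using assms
proof (induction T rule: finite_induct)
  case (insert x T)
  then show ?case using rank_insert_eq_mono[of X "X \<union> T" x] by simp
qed simp

lemma finite_subset_ground: "X \<subseteq> ground M \<Longrightarrow> finite X"
  by (rule finite_subset[OF _ finite_ground])

section \<open>Closure and flats\<close>

definition closure :: "'a set \<Rightarrow> 'a set" where
  "closure X = {x \<in> ground M. rank_of M (insert x X) = rank_of M X}"

lemma subset_closure: "X \<subseteq> ground M \<Longrightarrow> X \<subseteq> closure X"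
  by (auto simp: closure_def insert_absorb)

lemma closure_subset_ground: "closure X \<subseteq> ground M"
  by (auto simp: closure_def)

lemma closure_mono: "X \<subseteq> Y \<Longrightarrow> closure X \<subseteq> closure Y"
  using rank_insert_eq_mono by (auto simp: closure_def)

text \<open>Turns containment in a closure into an equation between ranks, which the type of a
  nested pair can express.\<close>

lemma subset_closure_iff:
  assumes "Y \<subseteq> X" "X \<subseteq> ground M"
  shows "X \<subseteq> closure Y \<longleftrightarrow> rank_of M X = rank_of M Y"
proof
  assume "X \<subseteq> closure Y"
  then have "rank_of M (Y \<union> X) = rank_of M Y"
    using finite_subset_ground[OF assms(2)] by (intro rank_union_eq) (auto simp: closure_def)
  then show "rank_of M X = rank_of M Y" using assms by (simp add: Un_absorb1)
next
  assume eq: "rank_of M X = rank_of M Y"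
  have "rank_of M (insert x Y) = rank_of M Y" if "x \<in> X" for x
    using rank_le_insert[of Y x] rank_mono[of "insert x Y" X] that assms eq by auto
  then show "X \<subseteq> closure Y" using assms by (auto simp: closure_def)
qed

lemma rank_closure: "X \<subseteq> ground M \<Longrightarrow> rank_of M (closure X) = rank_of M X"
  using subset_closure_iff[of X "closure X"] subset_closure closure_subset_ground by blast

lemma flat_iff_closure: "flat M X \<longleftrightarrow> X \<subseteq> ground M \<and> closure X = X"
proof -
  have "rank_of M X < rank_of M (insert x X) \<longleftrightarrow> rank_of M (insert x X) \<noteq> rank_of M X" for x
    using rank_le_insert[of X x] by auto
  then show ?thesis
    using subset_closure[of X] by (auto simp: flat_def closure_def)
qed

lemma closure_eq_of_rank_eq:
  assumes "X \<subseteq> Y" "Y \<subseteq> ground M" "rank_of M X = rank_of M Y"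
  shows "closure X = closure Y"
proof
  show "closure X \<subseteq> closure Y" using closure_mono assms by auto
  have Y: "Y \<subseteq> closure Y" "rank_of M (closure Y) = rank_of M Y"
    using assms subset_closure rank_closure by auto
  then show "closure Y \<subseteq> closure X"
    using subset_closure_iff[of X "closure Y"] assms closure_subset_ground by auto
qed

lemma flat_closure:
  assumes "X \<subseteq> ground M" shows "flat M (closure X)"
  using closure_eq_of_rank_eq[of X "closure X"] assms subset_closure[of X] rank_closure[of X]
    closure_subset_ground[of X] by (auto simp: flat_iff_closure)

lemma flat_eq_closure:
  assumes "flat M F" "X \<subseteq> F" "rank_of M X = rank_of M F"
  shows "closure X = F"
  using closure_eq_of_rank_eq[of X F] assms by (auto simp: flat_iff_closure)

text \<open>The coloops of the restriction of \<open>M\<close> to \<open>X\<close>: for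
  \<open>X\<close> inside the ground set, the elements of \<open>X\<close> that lie on no circuit
  within \<open>X\<close>.\<close>

definition coloops :: "'a set \<Rightarrow> 'a set" where
  "coloops X = {x \<in> X. rank_of M (X - {x}) < rank_of M X}"

text \<open>A coloop of X remains one after other elements are removed: if x were spanned by the
  smaller remainder, \<open>rank_insert_eq_mono\<close> would make it spanned by
  \<open>X - {x}\<close>. So every removal costs exactly one unit of rank.\<close>

lemma rank_diff_coloops:
  assumes "finite T" "T \<subseteq> coloops X"
  shows "rank_of M X = rank_of M (X - T) + card T"
  using assms
proof (induction T rule: finite_induct)
  case (insert x T)
  let ?Z = "X - insert x T"
  have x: "x \<in> X" "rank_of M (X - {x}) < rank_of M X" using insert.prems by (auto simp: coloops_def)
  have ins: "insert x ?Z = X - T" using x(1) insert.hyps(2) by blast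
  have "rank_of M (insert x ?Z) \<noteq> rank_of M ?Z"
  proof
    assume "rank_of M (insert x ?Z) = rank_of M ?Z"
    then have "rank_of M (insert x (X - {x})) = rank_of M (X - {x})"
      by (rule rank_insert_eq_mono[rotated]) auto
    then show False using x by (simp add: insert_absorb)
  qed
  then have "rank_of M (X - T) = Suc (rank_of M ?Z)"
    using rank_insert_le[of x ?Z] rank_le_insert[of ?Z x] unfolding ins by linarith
  moreover have "rank_of M X = rank_of M (X - T) + card T" using insert by auto
  ultimately show ?case using insert.hyps by simp
qed simp

text \<open>Removing an element costs at most one unit of rank. If passing from X to Y costs as many
  units as there are elements in X - Y, then the removal of each one of them from X must cost a
  unit.\<close>

lemma diff_subset_coloops_iff:
  assumes "Y \<subseteq> X" "finite X"
  shows "X - Y \<subseteq> coloops X \<longleftrightarrow> rank_of M X + card Y = rank_of M Y + card X"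
proof -
  have card: "card (X - Y) + card Y = card X"
    using assms by (simp add: card_Diff_subset finite_subset card_mono)
  show ?thesis
  proof
    assume "X - Y \<subseteq> coloops X"
    then have "rank_of M X = rank_of M (X - (X - Y)) + card (X - Y)"
      using assms by (intro rank_diff_coloops) auto
    also have "X - (X - Y) = Y" using assms(1) by blast
    finally show "rank_of M X + card Y = rank_of M Y + card X" using card by linarith
  next
    assume eq: "rank_of M X + card Y = rank_of M Y + card X"
    show "X - Y \<subseteq> coloops X"
    proof
      fix x assume x: "x \<in> X - Y"
      have "X - {x} = Y \<union> (X - Y - {x})" using x assms by auto
      then have "rank_of M (X - {x}) \<le> rank_of M Y + card (X - Y - {x})"
        using assms rank_union_le[of "X - Y - {x}" Y] by simp
      moreover have "Suc (card (X - Y - {x})) = card (X - Y)"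
        using x assms by (intro card_Suc_Diff1) auto
      ultimately have "rank_of M (X - {x}) < rank_of M X" using eq card by linarith
      then show "x \<in> coloops X" using x by (simp add: coloops_def)
    qed
  qed
qed

section \<open>Circuits and cyclic sets\<close>

lemma dependent_contains_circuit:
  assumes "X \<subseteq> ground M" "X \<notin> indep M"
  obtains C where "circuit M C" "C \<subseteq> X"
proof -
  have "\<exists>C. circuit M C \<and> C \<subseteq> X"
    using finite_subset_ground[OF assms(1)] assms
  proof (induction X rule: finite_psubset_induct)
    case (psubset X)
    show ?case
    proof (cases "\<exists>D. D \<subset> X \<and> D \<notin> indep M")
      case True
      then obtain D where D: "D \<subset> X" "D \<notin> indep M" by blast
      then obtain C where "circuit M C" "C \<subseteq> D" 
        using psubset.IH[OF D(1) subset_trans[OF psubset_imp_subset[OF D(1)] psubset.prems(1)] D(2)]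
        by blast
      then show ?thesis using D by blast
    next
      case False
      then show ?thesis using psubset by (auto simp: circuit_def)
    qed
  qed
  then show thesis using that by blast
qed

lemma circuit_rank:
  assumes "circuit M C"
  shows "Suc (rank_of M C) = card C" "\<And>x. x \<in> C \<Longrightarrow> rank_of M (C - {x}) = rank_of M C"
proof -
  have C: "C \<subseteq> ground M" "C \<notin> indep M" "\<And>D. D \<subset> C \<Longrightarrow> D \<in> indep M"
    using assms by (auto simp: circuit_def)
  have fin: "finite C" using C finite_subset_ground by auto
  have less: "rank_of M C < card C"
    using indep_iff_rank[OF fin] rank_le_card[OF fin] C by auto
  have del: "rank_of M (C - {x}) = rank_of M C \<and> Suc (rank_of M C) = card C" if "x \<in> C" for x
  proof -
    have "C - {x} \<in> indep M" using C(3)[of "C - {x}"] that by auto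
    then have "rank_of M (C - {x}) = card C - 1" using rank_indep that fin by simp
    then show ?thesis using less rank_mono[of "C - {x}" C] by auto
  qed
  have "C \<noteq> {}" using C empty_indep by auto
  then show "Suc (rank_of M C) = card C" using del by auto
  show "\<And>x. x \<in> C \<Longrightarrow> rank_of M (C - {x}) = rank_of M C" using del by auto
qed

text \<open>An element of a circuit in X is spanned by the rest of that circuit. Conversely, if x is
  not a coloop, a maximal independent set I of \<open>X - {x}\<close> has the rank of X, so
  \<open>insert x I\<close> is dependent, and a circuit in it must contain x because I is
  independent.\<close>

lemma cyclic_set_iff: "cyclic_set M X \<longleftrightarrow> X \<subseteq> ground M \<and> coloops X = {}"
proof
  assume "cyclic_set M X"
  then obtain \<C> where \<C>: "\<And>C. C \<in> \<C> \<Longrightarrow> circuit M C" "X = \<Union>\<C>"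
    by (auto simp: cyclic_set_def)
  have "x \<notin> coloops X" if "x \<in> X" for x
  proof -
    from that \<C> obtain C where C: "circuit M C" "C \<subseteq> X" "x \<in> C" by auto
    have "rank_of M (insert x (C - {x})) = rank_of M (C - {x})"
      using circuit_rank(2)[OF C(1,3)] C(3) by (simp add: insert_absorb)
    then have "rank_of M (insert x (X - {x})) = rank_of M (X - {x})"
      by (rule rank_insert_eq_mono[rotated]) (use C in auto)
    then show ?thesis using that by (simp add: coloops_def insert_absorb)
  qed
  moreover have "X \<subseteq> ground M" using \<C> by (auto simp: circuit_def)
  ultimately show "X \<subseteq> ground M \<and> coloops X = {}" by (auto simp: coloops_def)
next
  assume X: "X \<subseteq> ground M \<and> coloops X = {}"
  have "\<exists>C. circuit M C \<and> C \<subseteq> X \<and> x \<in> C" if "x \<in> X" for x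
  proof -
    obtain I where I: "I \<in> indep M" "I \<subseteq> X - {x}" "card I = rank_of M (X - {x})"
      by (rule obtain_rank_witness)
    have "rank_of M X \<le> card I" using X I that by (auto simp: coloops_def not_less)
    moreover have "card (insert x I) = Suc (card I)"
      using I finite_indep by (intro card_insert_disjoint) auto
    ultimately have "insert x I \<notin> indep M"
      using card_indep_le_rank[of "insert x I" X] I that by auto
    then obtain C where C: "circuit M C" "C \<subseteq> insert x I"
      using dependent_contains_circuit[of "insert x I"] I(2) \<open>x \<in> X\<close> X by blast
    moreover have "\<not> C \<subseteq> I" using C(1) indep_subset[OF I(1), of C] by (auto simp: circuit_def)
    ultimately show ?thesis using I(2) that by blast
  qed
  then show "cyclic_set M X"
    unfolding cyclic_set_def by (intro exI[of _ "{C. circuit M C \<and> C \<subseteq> X}"]) auto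
qed

text \<open>In a cyclic set, deleting one element keeps the rank; with nullity one, what remains has
  as many elements as its rank and is therefore independent.\<close>

lemma circuit_iff_cyclic_set: "circuit M C \<longleftrightarrow> cyclic_set M C \<and> card C = Suc (rank_of M C)"
proof
  assume C: "circuit M C"
  then have "cyclic_set M C" by (auto simp: cyclic_set_def intro!: exI[of _ "{C}"])
  then show "cyclic_set M C \<and> card C = Suc (rank_of M C)" using circuit_rank(1)[OF C] by simp
next
  assume C: "cyclic_set M C \<and> card C = Suc (rank_of M C)"
  then have fin: "C \<subseteq> ground M" "finite C" using cyclic_set_iff finite_subset_ground by auto
  have "D \<in> indep M" if "D \<subset> C" for D
  proof -
    from that obtain x where x: "x \<in> C" "D \<subseteq> C - {x}" by auto
    have "rank_of M (C - {x}) = rank_of M C"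
      using C x rank_mono[of "C - {x}" C] by (auto simp: cyclic_set_iff coloops_def)
    then have "C - {x} \<in> indep M" using indep_iff_rank[of "C - {x}"] C x fin by simp
    then show ?thesis using indep_subset x by blast
  qed
  moreover have "C \<notin> indep M" using C rank_indep by force
  ultimately show "circuit M C" using fin by (auto simp: circuit_def)
qed

section \<open>Bases, the dual and cocircuits\<close>

lemma basis_iff: "basis M B \<longleftrightarrow> B \<in> indep M \<and> card B = matroid_rank M"
proof
  assume B: "basis M B"
  then have "B \<in> indep M" by (simp add: basis_def)
  moreover from this obtain J where "J \<in> indep M" "B \<subseteq> J" "card J = matroid_rank M"
    using extend_to_rank_witness[of B "ground M"] indep_subset_ground
    by (auto simp: matroid_rank_def)
  ultimately show "B \<in> indep M \<and> card B = matroid_rank M" using B by (auto simp: basis_def)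
next
  assume B: "B \<in> indep M \<and> card B = matroid_rank M"
  have "I = B" if "I \<in> indep M" "B \<subseteq> I" for I
    using card_indep_le_rank[OF that(1) indep_subset_ground[OF that(1)]] that B
      card_seteq[OF finite_indep[OF that(1)] that(2)] by (auto simp: matroid_rank_def)
  then show "basis M B" using B by (auto simp: basis_def)
qed

text \<open>Lets cocircuits be treated through ranks in \<open>M\<close> alone.\<close>

lemma dual_indep_iff:
  "I \<in> indep (dual M) \<longleftrightarrow> I \<subseteq> ground M \<and> rank_of M (ground M - I) = matroid_rank M"
proof -
  have "(\<exists>B. basis M B \<and> I \<subseteq> ground M - B) \<longleftrightarrow> rank_of M (ground M - I) = matroid_rank M"
    if I: "I \<subseteq> ground M"
  proof
    assume "\<exists>B. basis M B \<and> I \<subseteq> ground M - B"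
    then obtain B where B: "B \<in> indep M" "card B = matroid_rank M" "I \<subseteq> ground M - B"
      using basis_iff by auto
    then have "matroid_rank M \<le> rank_of M (ground M - I)"
      using card_indep_le_rank[of B "ground M - I"] indep_subset_ground by fastforce
    then show "rank_of M (ground M - I) = matroid_rank M"
      using rank_mono[of "ground M - I" "ground M"] by (simp add: matroid_rank_def)
  next
    assume eq: "rank_of M (ground M - I) = matroid_rank M"
    obtain B where B: "B \<in> indep M" "B \<subseteq> ground M - I" "card B = rank_of M (ground M - I)"
      by (rule obtain_rank_witness)
    then have "basis M B" using eq by (simp add: basis_iff)
    then show "\<exists>B. basis M B \<and> I \<subseteq> ground M - B" using B(2) I by blast
  qed
  then show ?thesis by (auto simp: dual_def)
qed

text \<open>A cocircuit is a minimal set with non-spanning complement. By minimality, any one of its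
  elements completes the complement to full rank; this makes the complement a flat, and of corank
  one since a single element adds at most one to the rank.\<close>

lemma cocircuit_iff:
  "cocircuit M C \<longleftrightarrow>
     C \<subseteq> ground M \<and> flat M (ground M - C) \<and> Suc (rank_of M (ground M - C)) = matroid_rank M"
    (is "_ \<longleftrightarrow> ?R")
proof -
  have sub: "rank_of M X \<le> matroid_rank M" if "X \<subseteq> ground M" for X
    using rank_mono that by (simp add: matroid_rank_def)
  have "cocircuit M C \<longleftrightarrow> C \<subseteq> ground M \<and> rank_of M (ground M - C) < matroid_rank M \<and>
      (\<forall>D. D \<subset> C \<longrightarrow> rank_of M (ground M - D) = matroid_rank M)" (is "_ \<longleftrightarrow> ?L")
  proof -
    have "(\<forall>D. D \<subset> C \<longrightarrow> D \<in> indep (dual M)) \<longleftrightarrow>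
        (\<forall>D. D \<subset> C \<longrightarrow> rank_of M (ground M - D) = matroid_rank M)" if "C \<subseteq> ground M"
      using that unfolding dual_indep_iff by blast
    moreover have "C \<notin> indep (dual M) \<longleftrightarrow> rank_of M (ground M - C) < matroid_rank M"
      if "C \<subseteq> ground M"
      using that sub[of "ground M - C"] unfolding dual_indep_iff by auto
    moreover have "ground (dual M) = ground M" by (simp add: dual_def)
    ultimately show ?thesis unfolding cocircuit_def circuit_def by metis
  qed
  also have "?L \<longleftrightarrow> ?R"
  proof
    assume L: ?L
    have ins: "rank_of M (insert x (ground M - C)) = matroid_rank M" if "x \<in> C" for x
    proof -
      have "insert x (ground M - C) = ground M - (C - {x})" using L that by auto
      moreover have "C - {x} \<subset> C" using that by auto
      ultimately show ?thesis using L by metis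
    qed
    have "flat M (ground M - C)" using ins L by (auto simp: flat_def)
    \<comment> \<open>The complement of the empty set has full rank. An element of \<open>C\<close>
      is needed to bound the corank.\<close>
    moreover have "C \<noteq> {}" using L by (auto simp: matroid_rank_def)
    then obtain x where "x \<in> C" by auto
    then have "matroid_rank M \<le> Suc (rank_of M (ground M - C))"
      using ins[of x] rank_insert_le[of x "ground M - C"] by simp
    ultimately show ?R using L by auto
  next
    assume R: ?R
    have "rank_of M (ground M - D) = matroid_rank M" if D: "D \<subset> C" for D
    proof -
      from D obtain x where x: "x \<in> C" "x \<notin> D" by auto
      then have "rank_of M (ground M - C) < rank_of M (insert x (ground M - C))"
        using R by (auto simp: flat_def)
      also have "\<dots> \<le> rank_of M (ground M - D)" using x D R by (intro rank_mono) auto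
      finally show ?thesis using R sub[of "ground M - D"] by auto
    qed
    then show ?L using R by auto
  qed
  finally show ?thesis .
qed

end


section \<open>Counting nested pairs of sets\<close>

definition nested_pairs :: "'a indep_system \<Rightarrow> ('a set \<times> 'a set) set" where
  "nested_pairs M = (SIGMA X : Pow (ground M). Pow X)"

fun pair_type :: "'a indep_system \<Rightarrow> 'a set \<times> 'a set \<Rightarrow> nat \<times> nat \<times> nat \<times> nat" where
  "pair_type M (X, Y) = (card X, rank_of M X, card Y, rank_of M Y)"

text \<open>
  Inclusion-exclusion weights. For \<open>Y \<subseteq> X\<close>, the set \<open>X - Y\<close> consists of coloops of the restriction
  to \<open>X\<close> iff \<open>r(X) - r(Y) = |X| - |Y|\<close>, and \<open>X\<close> lies in the closure of \<open>Y\<close> iff \<open>r(X) = r(Y)\<close>; so both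
  conditions can be read off the type of the pair.
\<close>

fun cyclic_weight :: "nat \<Rightarrow> nat \<Rightarrow> nat \<times> nat \<times> nat \<times> nat \<Rightarrow> int" where
  "cyclic_weight s j (s', j', a, i) = (if s' = s \<and> j' = j \<and> j' + a = i + s' then (- 1) ^ (s' - a) else 0)"

fun flat_weight :: "nat \<Rightarrow> nat \<Rightarrow> nat \<times> nat \<times> nat \<times> nat \<Rightarrow> int" where
  "flat_weight a i (s, j, a', i') = (if a' = a \<and> i' = i \<and> j = i' then (- 1) ^ (s - a') else 0)"

text \<open>The G-invariant without its coefficient field: the multiplicity of a word is its
  coefficient. Catenary data and G-invariants are both reduced to this multiset.\<close>

definition rank_sequences :: "'a indep_system \<Rightarrow> nat list multiset" where
  "rank_sequences M = image_mset (rank_sequence M) (mset_set (permutations_of_set (ground M)))"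

lemma card_filter_image_mset_set:
  assumes "finite A"
  shows "card {x \<in> A. P (f x)} = size (filter_mset P (image_mset f (mset_set A)))"
  using assms by (simp add: filter_mset_image_mset)

text \<open>Such a permutation is an ordering of \<open>Y\<close>, then one of \<open>X - Y\<close>,
  then one of \<open>E - X\<close>; the block lengths are fixed, so the blocks can be recovered from
  the concatenation.\<close>

lemma card_permutations_with_prefix_sets:
  assumes "finite E" "Y \<subseteq> X" "X \<subseteq> E"
  shows "card {xs \<in> permutations_of_set E. set (take (card X) xs) = X \<and> set (take (card Y) xs) = Y} =
    fact (card Y) * fact (card X - card Y) * fact (card E - card X)"
proof -
  let ?P = "permutations_of_set Y \<times> permutations_of_set (X - Y) \<times> permutations_of_set (E - X)"
  let ?f = "\<lambda>(p, q, t). p @ q @ t"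
  have fin: "finite X" "finite Y" 
    using assms by (meson finite_subset order.trans)+
  have le: "card Y \<le> card X" "card X \<le> card E" using assms fin card_mono by auto
  have len: "length p = card Y" "length q = card X - card Y" if "(p, q, t) \<in> ?P" for p q t
    using that assms fin by (auto simp: permutations_of_set_def distinct_card[symmetric] card_Diff_subset)
  have "inj_on ?f ?P"
  proof (rule inj_onI)
    fix u v assume uv: "u \<in> ?P" "v \<in> ?P" "?f u = ?f v"
    obtain p q t p' q' t' where eq: "u = (p, q, t)" "v = (p', q', t')" by (metis prod_cases3)
    show "u = v" using uv len[of p q t] len[of p' q' t'] unfolding eq by simp
  qed
  moreover have "?f ` ?P =
      {xs \<in> permutations_of_set E. set (take (card X) xs) = X \<and> set (take (card Y) xs) = Y}" (is "_ = ?R")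
  proof (intro equalityI subsetI)
    fix xs assume "xs \<in> ?f ` ?P"
    then obtain p q t where pqt: "(p, q, t) \<in> ?P" "xs = p @ q @ t" by auto
    have "set p = Y" "set q = X - Y" "set t = E - X" "distinct p" "distinct q" "distinct t"
      using pqt(1) by (auto simp: permutations_of_set_def)
    then show "xs \<in> ?R"
      using len[OF pqt(1)] pqt(2) le assms(2,3) by (auto simp: permutations_of_set_def)
  next
    fix xs assume xs: "xs \<in> ?R"
    let ?p = "take (card Y) xs" and ?q = "take (card X - card Y) (drop (card Y) xs)"
      and ?t = "drop (card X) xs"
    have tX: "take (card X) xs = ?p @ ?q" using le by (metis le_add_diff_inverse take_add)
    have split: "xs = ?p @ ?q @ ?t" using tX by (metis append.assoc append_take_drop_id)
    have d: "distinct (?p @ ?q @ ?t)" "set (?p @ ?q @ ?t) = E" "set (?p @ ?q) = X" "set ?p = Y"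
      using xs split tX by (auto simp: permutations_of_set_def)
    then have "set ?q = X - Y" "set ?t = E - X" by auto
    then have "(?p, ?q, ?t) \<in> ?P" using d by (auto simp: permutations_of_set_def)
    then have "?f (?p, ?q, ?t) \<in> ?f ` ?P" by (rule imageI)
    then show "xs \<in> ?f ` ?P" by (simp only: prod.case split[symmetric])
  qed
  ultimately have "card ?R = card ?P" using card_image[of ?f ?P] by argo
  also have "\<dots> = fact (card Y) * fact (card X - card Y) * fact (card E - card X)"
    using assms fin by (simp add: card_cartesian_product card_Diff_subset)
  finally show ?thesis .
qed

context matroid
begin

lemma finite_nested_pairs: "finite (nested_pairs M)"
  unfolding nested_pairs_def using finite_ground finite_subset_ground by (intro finite_SigmaI) auto

lemma pair_type_bounds:
  assumes "p \<in> nested_pairs M" "pair_type M p = (s, j, a, i)"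
  shows "a \<le> s" "s \<le> card (ground M)"
proof -
  obtain X Y where p: "p = (X, Y)" by force
  then have "X \<subseteq> ground M" "Y \<subseteq> X" "card X = s" "card Y = a"
    using assms by (auto simp: nested_pairs_def)
  then show "a \<le> s" "s \<le> card (ground M)"
    using finite_ground finite_subset_ground[of X] card_mono by auto
qed

lemma sum_nested_pairs:
  "(\<Sum>p\<in>nested_pairs M. f p) = (\<Sum>X\<in>Pow (ground M). \<Sum>Y\<in>Pow X. f (X, Y))"
  unfolding nested_pairs_def using finite_ground finite_subset_ground by (subst sum.Sigma) auto

text \<open>For fixed X of the right size and rank, the complements T = X - Y of the sets Y with
  nonzero weight are exactly the subsets of \<open>coloops X\<close>, and their signs cancel unless
  X has no coloops.\<close>

lemma card_cyclic_sets:
  "int (card {X. cyclic_set M X \<and> card X = s \<and> rank_of M X = j}) =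
     (\<Sum>p\<in>nested_pairs M. cyclic_weight s j (pair_type M p))"
proof -
  have inner: "(\<Sum>Y\<in>Pow X. cyclic_weight s j (pair_type M (X, Y))) =
      (if cyclic_set M X \<and> card X = s \<and> rank_of M X = j then 1 else 0)" if X: "X \<in> Pow (ground M)" for X
  proof (cases "card X = s \<and> rank_of M X = j")
    case True
    have fin: "finite X" using X finite_subset_ground by simp
    have "(\<Sum>Y\<in>Pow X. cyclic_weight s j (pair_type M (X, Y))) =
        (\<Sum>Y\<in>Pow X. if X - Y \<subseteq> coloops X then (- 1) ^ (card X - card Y) else 0)"
      using True fin by (intro sum.cong) (auto simp: diff_subset_coloops_iff)
    also have "\<dots> = (\<Sum>Y\<in>{Y \<in> Pow X. X - Y \<subseteq> coloops X}. (- 1) ^ (card X - card Y))"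
      using fin by (subst sum.inter_filter) auto
    also have "\<dots> = (\<Sum>T\<in>Pow (coloops X). (- 1) ^ card T)"
      by (rule sum.reindex_bij_witness[of _ "\<lambda>T. X - T" "\<lambda>Y. X - Y"])
        (use fin in \<open>auto simp: coloops_def card_Diff_subset finite_subset double_diff\<close>)
    also have "\<dots> = (if coloops X = {} then 1 else 0)"
      using fin by (intro sum_Pow_minus_one_power_card) (auto simp: coloops_def)
    finally show ?thesis using True X by (simp add: cyclic_set_iff)
  next
    case False
    then show ?thesis by (intro trans[OF sum.neutral]) auto
  qed
  have "(\<Sum>p\<in>nested_pairs M. cyclic_weight s j (pair_type M p)) =
      (\<Sum>X\<in>Pow (ground M). \<Sum>Y\<in>Pow X. cyclic_weight s j (pair_type M (X, Y)))"
    by (rule sum_nested_pairs)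
  also have "\<dots> = (\<Sum>X\<in>Pow (ground M). if cyclic_set M X \<and> card X = s \<and> rank_of M X = j then 1 else 0)"
    using inner by (intro sum.cong) auto
  also have "\<dots> = int (card {X \<in> Pow (ground M). cyclic_set M X \<and> card X = s \<and> rank_of M X = j})"
    using finite_ground by (simp add: sum.inter_filter[symmetric])
  also have "{X \<in> Pow (ground M). cyclic_set M X \<and> card X = s \<and> rank_of M X = j} =
      {X. cyclic_set M X \<and> card X = s \<and> rank_of M X = j}" by (auto simp: cyclic_set_iff)
  finally show ?thesis by simp
qed

text \<open>Here the smaller set Y is fixed and X ranges over the interval from Y to its closure, so
  the signs cancel unless Y is closed.\<close>

lemma card_flats:
  "int (card {Y. flat M Y \<and> card Y = a \<and> rank_of M Y = i}) =
     (\<Sum>p\<in>nested_pairs M. flat_weight a i (pair_type M p))"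
proof -
  let ?E = "ground M"
  have inner: "(\<Sum>X\<in>{X \<in> Pow ?E. Y \<in> Pow X}. flat_weight a i (pair_type M (X, Y))) =
      (if flat M Y \<and> card Y = a \<and> rank_of M Y = i then 1 else 0)" if Y: "Y \<in> Pow ?E" for Y
  proof (cases "card Y = a \<and> rank_of M Y = i")
    case True
    have fin: "finite Y" using Y finite_subset_ground by simp
    have cl: "Y \<subseteq> closure Y" "closure Y \<subseteq> ?E" "finite (closure Y)"
      using Y subset_closure closure_subset_ground finite_subset_ground by auto
    have "(\<Sum>X\<in>{X \<in> Pow ?E. Y \<in> Pow X}. flat_weight a i (pair_type M (X, Y))) =
        (\<Sum>X\<in>{X \<in> Pow ?E. Y \<in> Pow X}. if X \<subseteq> closure Y then (- 1) ^ (card X - card Y) else 0)"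
      using True by (intro sum.cong) (auto simp: subset_closure_iff)
    also have "\<dots> = (\<Sum>X\<in>{X \<in> {X \<in> Pow ?E. Y \<in> Pow X}. X \<subseteq> closure Y}. (- 1) ^ (card X - card Y))"
      using finite_ground by (subst sum.inter_filter) auto
    also have "\<dots> = (\<Sum>T\<in>Pow (closure Y - Y). (- 1) ^ card T)"
      by (rule sum.reindex_bij_witness[of _ "\<lambda>T. Y \<union> T" "\<lambda>X. X - Y"])
        (use fin cl Y in \<open>auto simp: card_Diff_subset\<close>)
    also have "\<dots> = (if closure Y - Y = {} then 1 else 0)"
      using cl by (intro sum_Pow_minus_one_power_card) auto
    also have "closure Y - Y = {} \<longleftrightarrow> flat M Y" using Y cl by (auto simp: flat_iff_closure)
    finally show ?thesis using True by simp
  next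
    case False
    then show ?thesis by (intro trans[OF sum.neutral]) auto
  qed
  have "(\<Sum>p\<in>nested_pairs M. flat_weight a i (pair_type M p)) =
      (\<Sum>X\<in>Pow ?E. \<Sum>Y\<in>Pow X. flat_weight a i (pair_type M (X, Y)))"
    by (rule sum_nested_pairs)
  \<comment> \<open>The sum comes grouped by the larger set, while the cancellation happens for a
    fixed smaller one. Writing the inner range as a restriction of \<open>Pow ?E\<close> allows the
    exchange.\<close>
  also have "\<dots> = (\<Sum>X\<in>Pow ?E. \<Sum>Y\<in>{Y \<in> Pow ?E. Y \<in> Pow X}. flat_weight a i (pair_type M (X, Y)))"
    by (intro sum.cong) auto
  also have "\<dots> = (\<Sum>Y\<in>Pow ?E. \<Sum>X\<in>{X \<in> Pow ?E. Y \<in> Pow X}. flat_weight a i (pair_type M (X, Y)))"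
    using finite_ground by (intro sum.swap_restrict) auto
  also have "\<dots> = (\<Sum>Y\<in>Pow ?E. if flat M Y \<and> card Y = a \<and> rank_of M Y = i then 1 else 0)"
    using inner by (intro sum.cong) auto
  also have "\<dots> = int (card {Y \<in> Pow ?E. flat M Y \<and> card Y = a \<and> rank_of M Y = i})"
    using finite_ground by (simp add: sum.inter_filter[symmetric])
  also have "{Y \<in> Pow ?E. flat M Y \<and> card Y = a \<and> rank_of M Y = i} =
      {Y. flat M Y \<and> card Y = a \<and> rank_of M Y = i}" by (auto simp: flat_def)
  finally show ?thesis by simp
qed

text \<open>The case \<open>s = 0\<close> is separate because \<open>s - 1\<close> truncates to 0
  there, and the empty set is a cyclic set of size and rank 0 without being a circuit.\<close>

lemma card_circuits:
  "card {C. circuit M C \<and> card C = s} =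
     (if s = 0 then 0 else card {X. cyclic_set M X \<and> card X = s \<and> rank_of M X = s - 1})"
proof -
  have "{C. circuit M C \<and> card C = s} =
      (if s = 0 then {} else {X. cyclic_set M X \<and> card X = s \<and> rank_of M X = s - 1})"
    by (auto simp: circuit_iff_cyclic_set)
  then show ?thesis by simp
qed

text \<open>Complementation matches cocircuits with flats of corank one. The guard excludes
  truncated subtraction: for \<open>s\<close> above the size of the ground set an empty flat could
  be counted, and in rank 0 the whole ground set could.\<close>

lemma card_cocircuits:
  "card {C. cocircuit M C \<and> card C = s} =
     (if s \<le> card (ground M) \<and> 0 < matroid_rank M
      then card {Y. flat M Y \<and> card Y = card (ground M) - s \<and> rank_of M Y = matroid_rank M - 1}
      else 0)" (is "card ?L = (if ?c then card ?R else 0)")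
proof (cases ?c)
  case True
  have compl: "card (ground M - Y) = card (ground M) - card Y" "card Y \<le> card (ground M)"
    if "Y \<subseteq> ground M" for Y
    using that finite_subset_ground finite_ground by (auto simp: card_Diff_subset card_mono)
  have "bij_betw (\<lambda>C. ground M - C) ?L ?R"
  proof (rule bij_betw_byWitness[where f' = "\<lambda>Y. ground M - Y"])
    show "\<forall>C\<in>?L. ground M - (ground M - C) = C" "\<forall>Y\<in>?R. ground M - (ground M - Y) = Y"
      by (auto simp: cocircuit_iff flat_def)
    show "(\<lambda>C. ground M - C) ` ?L \<subseteq> ?R"
      using compl by (auto simp: cocircuit_iff)
    show "(\<lambda>Y. ground M - Y) ` ?R \<subseteq> ?L"
    proof (rule image_subsetI)
      fix Y assume Y: "Y \<in> ?R"
      then have "Y \<subseteq> ground M" by (auto simp: flat_def)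
      then show "ground M - Y \<in> ?L"
        using Y True compl[of Y] by (auto simp: cocircuit_iff double_diff)
    qed
  qed
  then have "card ?L = card ?R" by (rule bij_betw_same_card)
  then show ?thesis using True by simp
next
  case False
  have "?L = {}"
    using False finite_ground card_mono by (auto simp: cocircuit_iff)
  then show ?thesis using False by (simp only: if_False card.empty)
qed

lemma spanning_circuit_iff_card:
  "(\<exists>C. spanning_circuit M C) \<longleftrightarrow>
     card {X. cyclic_set M X \<and> card X = Suc (matroid_rank M) \<and> rank_of M X = matroid_rank M} \<noteq> 0"
proof -
  have "finite {X. cyclic_set M X \<and> card X = Suc (matroid_rank M) \<and> rank_of M X = matroid_rank M}"
    by (rule finite_subset[of _ "Pow (ground M)"]) (auto simp: cyclic_set_iff finite_ground)
  then show ?thesis by (auto simp: spanning_circuit_def circuit_iff_cyclic_set)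
qed

text \<open>The rank sequence telescopes; by monotonicity of rank none of its differences is
  truncated.\<close>

lemma rank_prefix:
  assumes "t \<le> length xs"
  shows "rank_of M (set (take t xs)) = sum_list (take t (rank_sequence M xs))"
  using assms
proof (induction t)
  case (Suc t)
  have "rank_of M (set (take t xs)) \<le> rank_of M (set (take (Suc t) xs))"
    by (intro rank_mono set_take_subset_set_take) simp
  moreover have "take (Suc t) (rank_sequence M xs) = take t (rank_sequence M xs) @
      [rank_of M (set (take (Suc t) xs)) - rank_of M (set (take t xs))]"
    using Suc.prems by (simp add: rank_sequence_def take_Suc_conv_app_nth)
  ultimately show ?case using Suc by simp
qed simp

text \<open>Group the permutations by their initial segments of lengths \<open>s\<close> and
  \<open>a\<close>. Every nested pair of the given type arises equally often, with a multiplicity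
  that depends on sizes only.\<close>

lemma card_permutations_with_prefix_ranks:
  assumes "a \<le> s" "s \<le> card (ground M)"
  shows "card {xs \<in> permutations_of_set (ground M).
        rank_of M (set (take s xs)) = j \<and> rank_of M (set (take a xs)) = i} =
      card {p \<in> nested_pairs M. pair_type M p = (s, j, a, i)} *
        (fact a * fact (s - a) * fact (card (ground M) - s))" (is "card ?S = card ?T * ?k")
proof -
  let ?g = "\<lambda>xs. (set (take s xs), set (take a xs))"
  have card_take: "card (set (take t xs)) = t"
    if "xs \<in> permutations_of_set (ground M)" "t \<le> card (ground M)" for t xs
    using that distinct_card[of xs] by (simp add: permutations_of_set_def distinct_card)
  have g: "?g ` ?S \<subseteq> ?T"
  proof (rule image_subsetI)
    fix xs assume xs: "xs \<in> ?S"
    have "set (take a xs) \<subseteq> set (take s xs)" using assms by (intro set_take_subset_set_take)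
    moreover have "set (take s xs) \<subseteq> ground M"
      using xs set_take_subset by (fastforce simp: permutations_of_set_def)
    ultimately show "?g xs \<in> ?T"
      using xs assms card_take by (auto simp: nested_pairs_def)
  qed
  have fib: "card {xs \<in> ?S. ?g xs = p} = ?k" if "p \<in> ?T" for p
  proof -
    obtain X Y where p: "p = (X, Y)" by force
    have XY: "Y \<subseteq> X" "X \<subseteq> ground M" "card X = s" "card Y = a" "rank_of M X = j" "rank_of M Y = i"
      using that p by (auto simp: nested_pairs_def)
    have "{xs \<in> ?S. ?g xs = p} = {xs \<in> permutations_of_set (ground M).
        set (take (card X) xs) = X \<and> set (take (card Y) xs) = Y}"
      using XY p by auto
    then show ?thesis
      using card_permutations_with_prefix_sets[OF finite_ground XY(1,2)] XY by simp
  qed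
  have "card ?S = (\<Sum>xs\<in>?S. 1)" by simp
  also have "\<dots> = (\<Sum>p\<in>?T. \<Sum>xs\<in>{xs \<in> ?S. ?g xs = p}. 1)"
    using g finite_nested_pairs by (intro sum.group[symmetric]) auto
  also have "\<dots> = (\<Sum>p\<in>?T. ?k)" using fib by (intro sum.cong) auto
  finally show ?thesis by simp
qed

end

text \<open>The common situation behind both halves of the theorem; the two ground sets may have
  different types.\<close>

locale equal_rank_sequences = M: matroid M + N: matroid N
  for M :: "'a indep_system" and N :: "'b indep_system" +
  assumes rank_sequences_eq: "rank_sequences M = rank_sequences N"
begin

text \<open>A single common rank sequence suffices: its length is the size of the ground set and its
  sum is the rank.\<close>

lemma ground_and_rank_eq: "card (ground M) = card (ground N)" "matroid_rank M = matroid_rank N"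
proof -
  obtain xs where xs: "set xs = ground M" "distinct xs"
    using finite_distinct_list[OF M.finite_ground] by blast
  then have "rank_sequence M xs \<in># rank_sequences M"
    by (simp add: rank_sequences_def permutations_of_setI)
  then obtain ys where "ys \<in> permutations_of_set (ground N)"
      and ys: "rank_sequence M xs = rank_sequence N ys"
    unfolding rank_sequences_eq by (auto simp: rank_sequences_def)
  then have ys: "set ys = ground N" "distinct ys" "rank_sequence M xs = rank_sequence N ys"
    by (auto simp: permutations_of_set_def)
  have len: "length xs = length ys" using arg_cong[OF ys(3), of length] by (simp add: rank_sequence_def)
  then show "card (ground M) = card (ground N)"
    using distinct_card[OF xs(2)] distinct_card[OF ys(2)] xs(1) ys(1) by simp
  show "matroid_rank M = matroid_rank N"
    using M.rank_prefix[of "length xs" xs] N.rank_prefix[of "length ys" ys] xs(1) ys len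
    by (simp add: matroid_rank_def)
qed

lemma card_pair_type_eq:
  "card {p \<in> nested_pairs M. pair_type M p = c} = card {p \<in> nested_pairs N. pair_type N p = c}"
proof -
  obtain s j a i where c: "c = (s, j, a, i)" by (metis prod_cases4)
  show ?thesis
  proof (cases "a \<le> s \<and> s \<le> card (ground M)")
    case True
    let ?Q = "\<lambda>w. sum_list (take s w) = j \<and> sum_list (take a w) = i"
    let ?k = "fact a * fact (s - a) * fact (card (ground M) - s) :: nat"
    have "{xs \<in> permutations_of_set (ground M).
          rank_of M (set (take s xs)) = j \<and> rank_of M (set (take a xs)) = i} =
        {xs \<in> permutations_of_set (ground M). ?Q (rank_sequence M xs)}"
      using True M.rank_prefix by (auto simp: permutations_of_set_def distinct_card[symmetric])
    moreover have "{xs \<in> permutations_of_set (ground N).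
          rank_of N (set (take s xs)) = j \<and> rank_of N (set (take a xs)) = i} =
        {xs \<in> permutations_of_set (ground N). ?Q (rank_sequence N xs)}"
      using True N.rank_prefix
      by (auto simp: permutations_of_set_def distinct_card[symmetric] ground_and_rank_eq(1))
    moreover have "card {xs \<in> permutations_of_set (ground M). ?Q (rank_sequence M xs)} =
        card {xs \<in> permutations_of_set (ground N). ?Q (rank_sequence N xs)}"
      using rank_sequences_eq
      by (simp add: card_filter_image_mset_set[where P = ?Q] rank_sequences_def)
    \<comment> \<open>Both sides count the same permutations; the factor \<open>?k\<close> is
      positive and cancels.\<close>
    ultimately have "card {p \<in> nested_pairs M. pair_type M p = c} * ?k =
        card {p \<in> nested_pairs N. pair_type N p = c} * ?k"
      using M.card_permutations_with_prefix_ranks[of a s j i]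
        N.card_permutations_with_prefix_ranks[of a s j i] True
      by (simp add: ground_and_rank_eq(1) c)
    then show ?thesis by simp
  next
    \<comment> \<open>No nested pair of either matroid has a type outside these bounds.\<close>
    case False
    then have "{p \<in> nested_pairs M. pair_type M p = c} = {}"
      using M.pair_type_bounds c by blast
    moreover have "{p \<in> nested_pairs N. pair_type N p = c} = {}"
      using False N.pair_type_bounds c unfolding ground_and_rank_eq(1) by blast
    ultimately show ?thesis by (simp only: card.empty)
  qed
qed

lemma sum_pair_type_eq:
  "(\<Sum>p\<in>nested_pairs M. w (pair_type M p)) = (\<Sum>p\<in>nested_pairs N. w (pair_type N p))"
proof -
  obtain h where h: "bij_betw h (nested_pairs M) (nested_pairs N)"
      "\<And>p. p \<in> nested_pairs M \<Longrightarrow> pair_type N (h p) = pair_type M p"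
    using exists_bij_betw_fibers[OF M.finite_nested_pairs N.finite_nested_pairs card_pair_type_eq] by blast
  show ?thesis
    using h(2) by (subst sum.reindex_bij_betw[OF h(1), symmetric]) (auto intro!: sum.cong)
qed

lemma card_cyclic_sets_eq:
  "card {X. cyclic_set M X \<and> card X = s \<and> rank_of M X = j} =
     card {X. cyclic_set N X \<and> card X = s \<and> rank_of N X = j}"
  using M.card_cyclic_sets[of s j] N.card_cyclic_sets[of s j] sum_pair_type_eq[of "cyclic_weight s j"]
  by simp

lemma card_flats_eq:
  "card {Y. flat M Y \<and> card Y = a \<and> rank_of M Y = i} =
     card {Y. flat N Y \<and> card Y = a \<and> rank_of N Y = i}"
  using M.card_flats[of a i] N.card_flats[of a i] sum_pair_type_eq[of "flat_weight a i"] by simp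

lemma card_circuits_eq:
  "card {C. circuit M C \<and> card C = s} = card {C. circuit N C \<and> card C = s}"
  by (simp add: M.card_circuits N.card_circuits card_cyclic_sets_eq)

lemma card_cocircuits_eq:
  "card {C. cocircuit M C \<and> card C = s} = card {C. cocircuit N C \<and> card C = s}"
  by (simp add: M.card_cocircuits N.card_cocircuits card_flats_eq ground_and_rank_eq)

lemma spanning_circuit_eq: "(\<exists>C. spanning_circuit M C) \<longleftrightarrow> (\<exists>C. spanning_circuit N C)"
  by (simp add: M.spanning_circuit_iff_card N.spanning_circuit_iff_card card_cyclic_sets_eq
      ground_and_rank_eq)

end


section \<open>Rank sequences from catenary data\<close>

lemma count_rank_sequences:
  "count (rank_sequences M) w = card {xs \<in> permutations_of_set (ground M). rank_sequence M xs = w}"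
  using card_filter_image_mset_set[of "permutations_of_set (ground M)" "\<lambda>v. v = w" "rank_sequence M"]
  by (simp add: rank_sequences_def filter_eq_replicate_mset)

lemma lookup_G_invariant:
  "Poly_Mapping.lookup (G_invariant M :: nat list \<Rightarrow>\<^sub>0 'k::field_char_0) w = of_nat (count (rank_sequences M) w)"
proof -
  have "Poly_Mapping.lookup (G_invariant M :: nat list \<Rightarrow>\<^sub>0 'k) w =
      (\<Sum>xs\<in>permutations_of_set (ground M). if rank_sequence M xs = w then 1 else 0)"
    by (simp add: G_invariant_def Poly_Mapping.lookup_sum Poly_Mapping.lookup_single when_def)
  also have "\<dots> = of_nat (card {xs \<in> permutations_of_set (ground M). rank_sequence M xs = w})"
    by (simp add: sum.inter_filter[symmetric])
  finally show ?thesis by (simp add: count_rank_sequences)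
qed

text \<open>Characteristic zero makes \<open>of_nat\<close> injective, so multiplicities can be
  recovered from coefficients.\<close>

lemma rank_sequences_eq_if_G_invariant_eq:
  assumes "(G_invariant M :: nat list \<Rightarrow>\<^sub>0 'k::field_char_0) = G_invariant N"
  shows "rank_sequences M = rank_sequences N"
proof (rule multiset_eqI)
  fix w
  have "(of_nat (count (rank_sequences M) w) :: 'k) = of_nat (count (rank_sequences N) w)"
    unfolding lookup_G_invariant[symmetric] assms ..
  then show "count (rank_sequences M) w = count (rank_sequences N) w" by simp
qed

text \<open>
  Along a permutation, the closures of the initial segments run through a flag. Conversely, for a
  given flag, the permutations inducing it are those whose word of levels is a restricted growth
  word, and the rank of an initial segment is then the largest level seen so far.
\<close>

definition level :: "'a set list \<Rightarrow> 'a \<Rightarrow> nat" where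
  "level Xs x = (LEAST j. x \<in> Xs ! j)"

text \<open>The inserted 0 is the rank of the empty segment. It is also the level of the loops,
  which may therefore stand anywhere in a restricted growth word.\<close>

definition top_level :: "nat list \<Rightarrow> nat" where
  "top_level u = Max (insert 0 (set u))"

definition restricted_growth :: "nat list \<Rightarrow> bool" where
  "restricted_growth u \<longleftrightarrow> (\<forall>t<length u. u ! t \<le> Suc (top_level (take t u)))"

definition level_steps :: "nat list \<Rightarrow> nat list" where
  "level_steps u = map (\<lambda>t. top_level (take (Suc t) u) - top_level (take t u)) [0..<length u]"

lemma top_level_Nil [simp]: "top_level [] = 0"
  by (simp add: top_level_def)

lemma top_level_snoc [simp]: "top_level (u @ [k]) = max k (top_level u)"
  by (simp add: top_level_def insert_commute[of 0 k])

lemma top_level_le_iff: "top_level u \<le> m \<longleftrightarrow> (\<forall>k\<in>set u. k \<le> m)"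
  by (simp add: top_level_def)

text \<open>A level-preserving bijection of the ground sets carries permutations to permutations
  with the same word of levels. Hence counts of words depend only on the sizes of the level
  sets.\<close>

lemma card_permutations_level_word_eq:
  fixes l :: "'a \<Rightarrow> nat" and l' :: "'b \<Rightarrow> nat"
  assumes "finite E" "finite E'" "\<And>k. card {x \<in> E. l x = k} = card {y \<in> E'. l' y = k}"
  shows "card {xs \<in> permutations_of_set E. Q (map l xs)} = card {ys \<in> permutations_of_set E'. Q (map l' ys)}"
proof -
  obtain h where h: "bij_betw h E E'" "\<And>x. x \<in> E \<Longrightarrow> l' (h x) = l x"
    using exists_bij_betw_fibers[OF assms] by blast
  have inj: "inj_on h E" and img: "h ` E = E'" using h(1) by (auto simp: bij_betw_def)
  have perms: "permutations_of_set E' = map h ` permutations_of_set E"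
    using permutations_of_set_image_inj[OF inj] img by simp
  have "Q (map l' (map h xs)) \<longleftrightarrow> Q (map l xs)" if "xs \<in> permutations_of_set E" for xs
  proof -
    have "map l' (map h xs) = map l xs" using that h(2) by (auto simp: permutations_of_set_def)
    then show ?thesis by (simp only:)
  qed
  then have "{ys \<in> permutations_of_set E'. Q (map l' ys)} =
      map h ` {xs \<in> permutations_of_set E. Q (map l xs)}"
    unfolding perms by blast
  moreover have "inj_on (map h) {xs \<in> permutations_of_set E. Q (map l xs)}"
  proof (rule inj_onI)
    fix xs ys assume xy: "xs \<in> {xs \<in> permutations_of_set E. Q (map l xs)}"
      "ys \<in> {xs \<in> permutations_of_set E. Q (map l xs)}" "map h xs = map h ys"
    then have "set xs \<union> set ys = E" by (simp add: permutations_of_set_def)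
    then show "xs = ys" using map_inj_on[OF xy(3)] inj by simp
  qed
  ultimately show ?thesis by (simp add: card_image)
qed

context matroid
begin

section \<open>Flags and the level words of permutations\<close>

definition flags :: "'a set list set" where
  "flags = {Xs. flag M Xs}"

lemma flag_nth_mono:
  assumes "flag M Xs" "i \<le> j" "j \<le> matroid_rank M"
  shows "Xs ! i \<subseteq> Xs ! j"
  using assms(2,3)
proof (induction j rule: dec_induct)
  case (step j)
  then have "Xs ! j \<subset> Xs ! Suc j" using assms(1) by (simp add: flag_def)
  moreover have "Xs ! i \<subseteq> Xs ! j" using step by simp
  ultimately show ?case by blast
qed simp

lemma flag_nth_subset_ground: "flag M Xs \<Longrightarrow> j \<le> matroid_rank M \<Longrightarrow> Xs ! j \<subseteq> ground M"
  by (simp add: flag_def flat_def)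

lemma finite_flags: "finite flags"
proof (rule finite_subset)
  show "flags \<subseteq> {Xs. set Xs \<subseteq> Pow (ground M) \<and> length Xs = Suc (matroid_rank M)}"
  proof
    fix Xs assume "Xs \<in> flags"
    then have Xs: "flag M Xs" by (simp add: flags_def)
    then have "length Xs = Suc (matroid_rank M)" by (simp add: flag_def)
    moreover have "X \<subseteq> ground M" if X: "X \<in> set Xs" for X
    proof -
      obtain j where "j < length Xs" "X = Xs ! j" using X by (auto simp: in_set_conv_nth)
      then show ?thesis using flag_nth_subset_ground[OF Xs, of j] \<open>length Xs = _\<close> by simp
    qed
    ultimately show "Xs \<in> {Xs. set Xs \<subseteq> Pow (ground M) \<and> length Xs = Suc (matroid_rank M)}" by auto
  qed
  show "finite {Xs. set Xs \<subseteq> Pow (ground M) \<and> length Xs = Suc (matroid_rank M)}"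
    using finite_ground by (intro finite_lists_length_eq) simp
qed

lemma level_le_iff:
  assumes "flag M Xs" "x \<in> ground M" "j \<le> matroid_rank M"
  shows "level Xs x \<le> j \<longleftrightarrow> x \<in> Xs ! j"
proof
  assume le: "level Xs x \<le> j"
  have "x \<in> Xs ! matroid_rank M" using assms by (simp add: flag_def)
  then have "x \<in> Xs ! level Xs x" unfolding level_def by (rule LeastI)
  then show "x \<in> Xs ! j" using flag_nth_mono[OF assms(1) le assms(3)] by blast
next
  assume "x \<in> Xs ! j"
  then show "level Xs x \<le> j" unfolding level_def by (rule Least_le)
qed

lemma level_le_rank: "flag M Xs \<Longrightarrow> x \<in> ground M \<Longrightarrow> level Xs x \<le> matroid_rank M"
  using level_le_iff[of Xs x "matroid_rank M"] by (simp add: flag_def)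

lemma flag_composition_levels:
  assumes "flag M Xs"
  shows "flag_composition Xs = map (\<lambda>k. card {x \<in> ground M. level Xs x = k}) [0..<Suc (matroid_rank M)]"
proof -
  have len: "length Xs = Suc (matroid_rank M)" using assms by (simp add: flag_def)
  have "(if k = 0 then card (Xs ! 0) else card (Xs ! k - Xs ! (k - 1))) =
      card {x \<in> ground M. level Xs x = k}" if k: "k \<le> matroid_rank M" for k
  proof (cases k)
    case 0
    have "Xs ! 0 = {x \<in> ground M. level Xs x = 0}"
      using level_le_iff[OF assms, of _ 0] flag_nth_subset_ground[OF assms, of 0] by auto
    then show ?thesis using 0 by simp
  next
    case (Suc i)
    have "x \<in> Xs ! k - Xs ! i \<longleftrightarrow> level Xs x = k" if "x \<in> ground M" for x
      using level_le_iff[OF assms that, of k] level_le_iff[OF assms that, of i] k Suc by auto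
    then have "Xs ! k - Xs ! i = {x \<in> ground M. level Xs x = k}"
      using flag_nth_subset_ground[OF assms k] by blast
    then show ?thesis using Suc by simp
  qed
  then have "\<forall>k\<in>{0..<Suc (matroid_rank M)}.
      (if k = 0 then card (Xs ! 0) else card (Xs ! k - Xs ! (k - 1))) =
      card {x \<in> ground M. level Xs x = k}"
    by (metis atLeastLessThan_iff less_Suc_eq_le)
  then show ?thesis unfolding flag_composition_def len by (simp only: map_eq_conv set_upt)
qed

text \<open>The default 0 beyond the rank covers all levels, so equal compositions give equal level
  sizes for every \<open>k\<close>.\<close>

lemma card_level_eq:
  assumes "flag M Xs"
  shows "card {x \<in> ground M. level Xs x = k} =
    (if k < length (flag_composition Xs) then flag_composition Xs ! k else 0)"
proof (cases "k \<le> matroid_rank M")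
  case True
  then show ?thesis unfolding flag_composition_levels[OF assms] by (simp add: nth_append del: upt_Suc)
next
  case False
  then have "{x \<in> ground M. level Xs x = k} = {}" using level_le_rank[OF assms] by auto
  moreover have "\<not> k < length (flag_composition Xs)"
    using False unfolding flag_composition_levels[OF assms] by simp
  ultimately show ?thesis by (simp only: card.empty if_False)
qed

text \<open>Ensures that every flag is counted by some entry of the catenary data.\<close>

lemma is_composition_flag_composition:
  assumes "flag M Xs"
  shows "is_composition (card (ground M)) (matroid_rank M) (flag_composition Xs)"
proof -
  have len: "length Xs = Suc (matroid_rank M)" using assms by (simp add: flag_def)
  have "0 < flag_composition Xs ! j" if j: "1 \<le> j" "j \<le> matroid_rank M" for j
  proof -
    obtain i where i: "j = Suc i" using j by (cases j) auto
    have "Xs ! i \<subset> Xs ! j" using assms j i by (simp add: flag_def)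
    moreover have "finite (Xs ! j)" using flag_nth_subset_ground[OF assms j(2)] finite_subset_ground by auto
    ultimately have "0 < card (Xs ! j - Xs ! i)" by (auto simp: card_gt_0_iff)
    then show ?thesis using j i len by (simp add: flag_composition_def del: upt_Suc)
  qed
  moreover have "sum_list (flag_composition Xs) = card (ground M)"
  proof -
    have "sum_list (flag_composition Xs) =
        (\<Sum>k\<in>{0..<Suc (matroid_rank M)}. \<Sum>x\<in>{x \<in> ground M. level Xs x = k}. 1)"
      unfolding flag_composition_levels[OF assms] by (subst interv_sum_list_conv_sum_set_nat) simp
    also have "\<dots> = (\<Sum>x\<in>ground M. 1)"
      using finite_ground level_le_rank[OF assms] by (intro sum.group) (auto simp: less_Suc_eq_le)
    finally show ?thesis by simp
  qed
  moreover have "length (flag_composition Xs) = matroid_rank M + 1"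
    using len by (simp add: flag_composition_def)
  ultimately show ?thesis by (simp add: is_composition_def)
qed

text \<open>Induction along the word with m the top level so far. An element of level at most m
  keeps the segment inside the m-th flat, of rank m. Otherwise its level is m + 1 and it lies
  outside that flat, so the segment does not span it and the rank rises by exactly one.\<close>

lemma restricted_growth_prefix:
  assumes flag: "flag M Xs" and xs: "set xs \<subseteq> ground M"
    and growth: "restricted_growth (map (level Xs) xs)" and "t \<le> length xs"
  shows "rank_of M (set (take t xs)) = top_level (take t (map (level Xs) xs)) \<and>
    top_level (take t (map (level Xs) xs)) \<le> matroid_rank M \<and>
    set (take t xs) \<subseteq> Xs ! top_level (take t (map (level Xs) xs))"
  using assms(4)
proof (induction t)
  case (Suc t)
  let ?m = "top_level (take t (map (level Xs) xs))" and ?S = "set (take t xs)" and ?x = "xs ! t"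
  have IH: "rank_of M ?S = ?m" "?m \<le> matroid_rank M" "?S \<subseteq> Xs ! ?m" using Suc by auto
  have x: "?x \<in> ground M" using xs Suc.prems by auto
  have S: "set (take (Suc t) xs) = insert ?x ?S" using Suc.prems by (simp add: take_Suc_conv_app_nth)
  have top: "top_level (take (Suc t) (map (level Xs) xs)) = max (level Xs ?x) ?m"
    using Suc.prems by (simp add: take_Suc_conv_app_nth)
  have lx: "level Xs ?x \<le> Suc ?m"
    using growth Suc.prems by (auto simp: restricted_growth_def)
  have rk: "rank_of M (Xs ! j) = j" "flat M (Xs ! j)" if "j \<le> matroid_rank M" for j
    using flag that by (auto simp: flag_def)
  have le: "max (level Xs ?x) ?m \<le> matroid_rank M" using level_le_rank[OF flag x] IH by simp
  have sub: "insert ?x ?S \<subseteq> Xs ! max (level Xs ?x) ?m"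
    using level_le_iff[OF flag x le] IH(3) flag_nth_mono[OF flag _ le, of ?m] by auto
  have "rank_of M (insert ?x ?S) = max (level Xs ?x) ?m"
  proof (cases "level Xs ?x \<le> ?m")
    case True
    then have "rank_of M (insert ?x ?S) \<le> ?m"
      using rank_mono[OF sub] rk(1)[of ?m] IH(2) by (simp add: max_def)
    then show ?thesis using True rank_le_insert[of ?S ?x] IH(1) by (simp add: max_def)
  next
    case False
    then have notin: "?x \<notin> Xs ! ?m" using level_le_iff[OF flag x IH(2)] by simp
    have "rank_of M (insert ?x ?S) \<noteq> rank_of M ?S"
    proof
      assume "rank_of M (insert ?x ?S) = rank_of M ?S"
      then have "rank_of M (insert ?x (Xs ! ?m)) = rank_of M (Xs ! ?m)"
        by (rule rank_insert_eq_mono[OF IH(3)])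
      moreover have "rank_of M (Xs ! ?m) < rank_of M (insert ?x (Xs ! ?m))"
        using rk(2)[OF IH(2)] x notin unfolding flat_def by blast
      ultimately show False by simp
    qed
    then show ?thesis
      using rank_le_insert[of ?S ?x] rank_insert_le[of ?x ?S] IH(1) False lx by simp
  qed
  then show ?case using S top le sub by simp
qed simp

lemma restricted_growth_rank_sequence:
  assumes "flag M Xs" "set xs \<subseteq> ground M" "restricted_growth (map (level Xs) xs)"
  shows "rank_sequence M xs = level_steps (map (level Xs) xs)"
  unfolding rank_sequence_def level_steps_def length_map
proof (rule map_cong)
  fix t assume "t \<in> set [0..<length xs]"
  then have "t \<le> length xs" "Suc t \<le> length xs" by auto
  then show "rank_of M (set (take (Suc t) xs)) - rank_of M (set (take t xs)) =
      top_level (take (Suc t) (map (level Xs) xs)) - top_level (take t (map (level Xs) xs))"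
    using restricted_growth_prefix[OF assms] by metis
qed simp

text \<open>A discrete intermediate value argument: the rank starts at 0 and rises by at most one
  with each new element.\<close>

lemma prefix_rank_attained:
  assumes "set xs = ground M" "j \<le> matroid_rank M"
  shows "\<exists>t\<le>length xs. rank_of M (set (take t xs)) = j"
proof -
  let ?\<rho> = "\<lambda>t. rank_of M (set (take t xs))"
  let ?t = "LEAST t. j \<le> ?\<rho> t"
  have len: "j \<le> ?\<rho> (length xs)" using assms by (simp add: matroid_rank_def)
  then have t: "j \<le> ?\<rho> ?t" by (rule LeastI)
  have tl: "?t \<le> length xs" using len by (rule Least_le)
  have "?\<rho> ?t \<le> j"
  proof (cases ?t)
    case 0
    then show ?thesis by simp
  next
    case (Suc t)
    then have "?\<rho> t < j" using not_less_Least[of t "\<lambda>t. j \<le> ?\<rho> t"] by simp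
    moreover have "set (take (Suc t) xs) = insert (xs ! t) (set (take t xs))"
      using Suc tl by (simp add: take_Suc_conv_app_nth)
    ultimately show ?thesis using rank_insert_le[of "xs ! t" "set (take t xs)"] Suc by simp
  qed
  then show ?thesis using t tl by (intro exI[of _ ?t]) simp
qed

text \<open>A segment of rank j lies in the flat of rank j of the flag, which must then be its
  closure; segments of every rank occur.\<close>

lemma restricted_growth_flag_unique:
  assumes xs: "set xs = ground M"
    and Xs: "flag M Xs" "restricted_growth (map (level Xs) xs)"
    and Ys: "flag M Ys" "restricted_growth (map (level Ys) xs)"
  shows "Xs = Ys"
proof -
  have nth: "Zs ! rank_of M (set (take t xs)) = closure (set (take t xs))"
    if "flag M Zs" "restricted_growth (map (level Zs) xs)" "t \<le> length xs" for Zs t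
  proof -
    have pre: "rank_of M (set (take t xs)) \<le> matroid_rank M"
        "set (take t xs) \<subseteq> Zs ! rank_of M (set (take t xs))"
      using restricted_growth_prefix[OF that(1) _ that(2,3)] xs by auto
    then have "flat M (Zs ! rank_of M (set (take t xs)))"
        "rank_of M (Zs ! rank_of M (set (take t xs))) = rank_of M (set (take t xs))"
      using that(1) by (auto simp: flag_def)
    then show ?thesis using flat_eq_closure[OF _ pre(2)] by simp
  qed
  show ?thesis
  proof (rule nth_equalityI)
    show "length Xs = length Ys" using Xs(1) Ys(1) by (simp add: flag_def)
    fix j assume "j < length Xs"
    then have "j \<le> matroid_rank M" using Xs(1) by (simp add: flag_def)
    then obtain t where "t \<le> length xs" "rank_of M (set (take t xs)) = j"
      using prefix_rank_attained[OF xs] by blast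
    then show "Xs ! j = Ys ! j" using nth[OF Xs] nth[OF Ys] by metis
  qed
qed

lemma restricted_growth_flag_exists:
  assumes xs: "set xs = ground M"
  shows "\<exists>Xs. flag M Xs \<and> restricted_growth (map (level Xs) xs)"
proof -
  let ?S = "\<lambda>t. set (take t xs)" and ?r = "matroid_rank M"
  have sub: "?S t \<subseteq> ground M" for t using xs set_take_subset by fast
  have mono: "?S t \<subseteq> ?S t'" if "t \<le> t'" for t t' using that by (rule set_take_subset_set_take)
  \<comment> \<open>The choice among segments of rank j is immaterial: they are nested, and nested
    sets of equal rank have the same closure.\<close>
  obtain \<tau> where \<tau>: "\<And>j. j \<le> ?r \<Longrightarrow> rank_of M (?S (\<tau> j)) = j"
    using prefix_rank_attained[OF xs] by metis
  define Xs where "Xs = map (\<lambda>j. closure (?S (\<tau> j))) [0..<Suc ?r]"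
  have nth: "Xs ! j = closure (?S (\<tau> j))" if "j \<le> ?r" for j
    using that unfolding Xs_def by (simp add: nth_append del: upt_Suc)
  have rk: "rank_of M (Xs ! j) = j" "flat M (Xs ! j)" if "j \<le> ?r" for j
    using that nth \<tau> rank_closure[OF sub] flat_closure[OF sub] by auto
  have pre: "Xs ! rank_of M (?S t) = closure (?S t)" for t
  proof -
    have le: "rank_of M (?S t) \<le> ?r" using rank_mono[OF sub] by (simp add: matroid_rank_def)
    have "closure (?S (\<tau> (rank_of M (?S t)))) = closure (?S t)"
    proof (cases "\<tau> (rank_of M (?S t)) \<le> t")
      case True
      then show ?thesis using closure_eq_of_rank_eq[OF mono[OF True] sub] \<tau>[OF le] by simp
    next
      case False
      then have "t \<le> \<tau> (rank_of M (?S t))" by simp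
      then show ?thesis using closure_eq_of_rank_eq[OF mono sub, of t] \<tau>[OF le] by simp
    qed
    then show ?thesis using nth[OF le] by simp
  qed
  have flag: "flag M Xs"
    unfolding flag_def
  proof (intro conjI allI impI)
    show "length Xs = ?r + 1" by (simp add: Xs_def)
    show "flat M (Xs ! j)" "rank_of M (Xs ! j) = j" if "j \<le> ?r" for j using rk that by auto
    show "Xs ! j \<subset> Xs ! Suc j" if j: "j < ?r" for j
    proof -
      have "\<tau> j \<le> \<tau> (Suc j)"
      proof (rule ccontr)
        assume "\<not> \<tau> j \<le> \<tau> (Suc j)"
        then have "?S (\<tau> (Suc j)) \<subseteq> ?S (\<tau> j)" by (intro mono) simp
        then show False using rank_mono[of "?S (\<tau> (Suc j))" "?S (\<tau> j)"] \<tau>[of j] \<tau>[of "Suc j"] j by simp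
      qed
      then have "Xs ! j \<subseteq> Xs ! Suc j" using j nth closure_mono[OF mono] by simp
      moreover have "Xs ! j \<noteq> Xs ! Suc j" using rk(1)[of j] rk(1)[of "Suc j"] j by auto
      ultimately show ?thesis by auto
    qed
    show "Xs ! ?r = ground M"
      using flat_eq_closure[of "ground M" "?S (\<tau> ?r)"] sub nth[of ?r] \<tau>[of ?r]
      by (simp add: flat_def matroid_rank_def)
  qed
  have "level Xs (xs ! t) \<le> Suc (top_level (take t (map (level Xs) xs)))" if t: "t < length xs" for t
  proof -
    have le: "rank_of M (?S t') \<le> ?r" for t' using rank_mono[OF sub] by (simp add: matroid_rank_def)
    let ?m = "top_level (take t (map (level Xs) xs))"
    have "xs ! t \<in> ?S (Suc t)" using t by (simp add: take_Suc_conv_app_nth)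
    then have "xs ! t \<in> Xs ! rank_of M (?S (Suc t))" unfolding pre using subset_closure[OF sub] by blast
    moreover have x: "xs ! t \<in> ground M" using nth_mem[OF t] xs by simp
    ultimately have "level Xs (xs ! t) \<le> rank_of M (?S (Suc t))" using level_le_iff[OF flag x le] by simp
    also have "\<dots> \<le> Suc (rank_of M (?S t))"
      using rank_insert_le[of "xs ! t" "?S t"] t by (simp add: take_Suc_conv_app_nth)
    \<comment> \<open>All levels in the segment are at most \<open>?m\<close>, so it is contained in
      the flat of rank \<open>?m\<close>.\<close>
    also have "rank_of M (?S t) \<le> ?m"
    proof -
      have m: "?m \<le> ?r"
        unfolding top_level_le_iff using level_le_rank[OF flag] sub[of t] by (auto simp: take_map)
      have "y \<in> Xs ! ?m" if y: "y \<in> ?S t" for y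
      proof -
        have "level Xs y \<le> ?m" 
          using y top_level_le_iff[of "take t (map (level Xs) xs)" ?m] by (simp add: take_map)
        then show ?thesis using level_le_iff[OF flag _ m, of y] y sub by blast
      qed
      then show ?thesis using rank_mono[of "?S t" "Xs ! ?m"] rk(1)[OF m] by auto
    qed
    finally show ?thesis by simp
  qed
  then have "restricted_growth (map (level Xs) xs)" by (simp add: restricted_growth_def)
  then show ?thesis using flag by blast
qed

text \<open>By existence and uniqueness of the induced flag, the permutations with rank sequence
  \<open>w\<close> split into disjoint classes, one for each flag.\<close>

lemma count_rank_sequences_flags:
  "count (rank_sequences M) w =
     (\<Sum>Xs\<in>flags. card {xs \<in> permutations_of_set (ground M).
        restricted_growth (map (level Xs) xs) \<and> level_steps (map (level Xs) xs) = w})"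
proof -
  let ?P = "permutations_of_set (ground M)"
  let ?A = "\<lambda>Xs. {xs \<in> ?P. restricted_growth (map (level Xs) xs) \<and> level_steps (map (level Xs) xs) = w}"
  have P: "set xs = ground M" if "xs \<in> ?P" for xs using that by (simp add: permutations_of_set_def)
  have "{xs \<in> ?P. rank_sequence M xs = w} = (\<Union>Xs\<in>flags. ?A Xs)"
  proof (intro equalityI subsetI)
    fix xs assume xs: "xs \<in> {xs \<in> ?P. rank_sequence M xs = w}"
    then obtain Xs where Xs: "flag M Xs" "restricted_growth (map (level Xs) xs)"
      using restricted_growth_flag_exists P by blast
    then have "xs \<in> ?A Xs" using xs restricted_growth_rank_sequence[OF Xs(1) _ Xs(2)] P by auto
    then show "xs \<in> (\<Union>Xs\<in>flags. ?A Xs)" using Xs(1) by (auto simp: flags_def)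
  next
    fix xs assume "xs \<in> (\<Union>Xs\<in>flags. ?A Xs)"
    then obtain Xs where Xs: "flag M Xs" "xs \<in> ?A Xs" by (auto simp: flags_def)
    then show "xs \<in> {xs \<in> ?P. rank_sequence M xs = w}"
      using restricted_growth_rank_sequence[OF Xs(1), of xs] P by auto
  qed
  then have "count (rank_sequences M) w = card (\<Union>Xs\<in>flags. ?A Xs)"
    by (simp add: count_rank_sequences)
  also have "\<dots> = (\<Sum>Xs\<in>flags. card (?A Xs))"
  proof (rule card_UN_disjoint)
    show "\<forall>Xs\<in>flags. \<forall>Ys\<in>flags. Xs \<noteq> Ys \<longrightarrow> ?A Xs \<inter> ?A Ys = {}"
      using restricted_growth_flag_unique P unfolding flags_def by blast
  qed (simp_all add: finite_flags)
  finally show ?thesis .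
qed

end

lemma catenary_data_eq_ground_and_rank:
  assumes "matroid M" "catenary_data M = catenary_data N"
  shows "card (ground M) = card (ground N)" "matroid_rank M = matroid_rank N"
proof -
  interpret matroid M by fact
  let ?n = "card (ground M)" and ?r = "matroid_rank M"
  \<comment> \<open>This composition always exists, so the domain of the catenary data is nonempty,
    and any of its members reveals n as its sum and r from its length.\<close>
  let ?a = "(?n - ?r) # replicate ?r 1"
  have "?r \<le> ?n" using rank_le_card[OF finite_ground] by (simp add: matroid_rank_def)
  then have "is_composition ?n ?r ?a"
    by (auto simp: is_composition_def nth_Cons' sum_list_replicate)
  then have "catenary_data N ?a \<noteq> None"
    unfolding assms(2)[symmetric] by (simp add: catenary_data_def)
  then have N: "is_composition (card (ground N)) (matroid_rank N) ?a"
    by (auto simp: catenary_data_def split: if_splits)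
  then show "?r = matroid_rank N" by (simp add: is_composition_def)
  from N show "?n = card (ground N)"
    using \<open>?r \<le> ?n\<close> by (simp add: is_composition_def sum_list_replicate)
qed

text \<open>Two nested matchings: flags are matched by composition, and for two matched flags the
  permutations are matched by level words.\<close>

lemma rank_sequences_eq_if_catenary_data_eq:
  assumes "matroid M" "matroid N" and eq: "catenary_data M = catenary_data N"
  shows "rank_sequences M = rank_sequences N"
proof (rule multiset_eqI)
  fix w
  interpret M: matroid M by fact
  interpret N: matroid N by fact
  have nr: "card (ground N) = card (ground M)" "matroid_rank N = matroid_rank M"
    using catenary_data_eq_ground_and_rank[OF assms(1) eq] by simp_all
  have "card {Xs \<in> M.flags. flag_composition Xs = a} = card {Ys \<in> N.flags. flag_composition Ys = a}" for a
  proof (cases "is_composition (card (ground M)) (matroid_rank M) a")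
    case True
    then have "flag_count M a = flag_count N a"
      using fun_cong[OF eq, of a] by (simp add: catenary_data_def nr)
    then show ?thesis by (simp add: flag_count_def M.flags_def N.flags_def)
  next
    \<comment> \<open>Off the index set the data are silent, but no flag has such a
      composition.\<close>
    case False
    then have "{Xs \<in> M.flags. flag_composition Xs = a} = {}" "{Ys \<in> N.flags. flag_composition Ys = a} = {}"
      using M.is_composition_flag_composition N.is_composition_flag_composition nr
      by (auto simp: M.flags_def N.flags_def)
    then show ?thesis by (simp only: card.empty)
  qed
  then obtain h where h: "bij_betw h M.flags N.flags"
      "\<And>Xs. Xs \<in> M.flags \<Longrightarrow> flag_composition (h Xs) = flag_composition Xs"
    using exists_bij_betw_fibers[OF M.finite_flags N.finite_flags, of flag_composition flag_composition]
    by blast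
  let ?Q = "\<lambda>u. restricted_growth u \<and> level_steps u = w"
  have "count (rank_sequences M) w =
      (\<Sum>Xs\<in>M.flags. card {xs \<in> permutations_of_set (ground M). ?Q (map (level Xs) xs)})"
    by (rule M.count_rank_sequences_flags)
  also have "\<dots> = (\<Sum>Xs\<in>M.flags. card {ys \<in> permutations_of_set (ground N). ?Q (map (level (h Xs)) ys)})"
  proof (rule sum.cong)
    fix Xs assume Xs: "Xs \<in> M.flags"
    then have "flag M Xs" "flag N (h Xs)"
      using bij_betw_apply[OF h(1)] by (auto simp: M.flags_def N.flags_def)
    then show "card {xs \<in> permutations_of_set (ground M). ?Q (map (level Xs) xs)} =
        card {ys \<in> permutations_of_set (ground N). ?Q (map (level (h Xs)) ys)}"
      using h(2)[OF Xs] M.finite_ground N.finite_ground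
      by (intro card_permutations_level_word_eq) (simp_all add: M.card_level_eq N.card_level_eq)
  qed simp
  also have "\<dots> = (\<Sum>Ys\<in>N.flags. card {ys \<in> permutations_of_set (ground N). ?Q (map (level Ys) ys)})"
    by (rule sum.reindex_bij_betw[OF h(1)])
  also have "\<dots> = count (rank_sequences N) w"
    by (rule N.count_rank_sequences_flags[symmetric])
  finally show "count (rank_sequences M) w = count (rank_sequences N) w" .
qed


section \<open>Cycle matroids\<close>

context multigraph
begin

section \<open>Connectivity by a set of edges\<close>

definition adjacent :: "'e set \<Rightarrow> 'v \<Rightarrow> 'v \<Rightarrow> bool" where
  "adjacent I u v \<longleftrightarrow> (\<exists>e\<in>I. ends G e = {u, v})"

abbreviation joined :: "'e set \<Rightarrow> 'v \<Rightarrow> 'v \<Rightarrow> bool" where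
  "joined I \<equiv> (adjacent I)\<^sup>*\<^sup>*"

definition component :: "'e set \<Rightarrow> 'v \<Rightarrow> 'v set" where
  "component I v = {w \<in> verts G. joined I v w}"

definition components :: "'e set \<Rightarrow> 'v set set" where
  "components I = component I ` verts G"

lemma joined_sym: "joined I u v \<Longrightarrow> joined I v u"
proof (induction rule: rtranclp_induct)
  case (step y z)
  then have "adjacent I z y" by (auto simp: adjacent_def insert_commute)
  then show ?case using step by (meson converse_rtranclp_into_rtranclp)
qed simp

lemma joined_trans: "joined I u v \<Longrightarrow> joined I v w \<Longrightarrow> joined I u w"
  by (rule rtranclp_trans)

lemma joined_mono: "I \<subseteq> J \<Longrightarrow> joined I u v \<Longrightarrow> joined J u v"
  using rtranclp_mono[of "adjacent I" "adjacent J"] unfolding adjacent_def by blast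

lemma joined_ends: "e \<in> I \<Longrightarrow> ends G e = {u, v} \<Longrightarrow> joined I u v"
  by (rule r_into_rtranclp) (auto simp: adjacent_def)

lemma joined_if_edges_joined:
  assumes "\<And>e u v. e \<in> J \<Longrightarrow> ends G e = {u, v} \<Longrightarrow> joined I u v" "joined J x y"
  shows "joined I x y"
  using assms(2)
proof (induction rule: rtranclp_induct)
  case (step y z)
  then obtain e where "e \<in> J" "ends G e = {y, z}" by (auto simp: adjacent_def)
  then show ?case using assms(1) step.IH joined_trans by blast
qed simp

text \<open>If joining by \<open>I\<close> is coarser, then saturating a component of
  \<open>J\<close> under \<open>I\<close> gives a component of \<open>I\<close>, and all of them
  arise in this way.\<close>

lemma card_components_antimono:
  assumes "\<And>x y. joined J x y \<Longrightarrow> joined I x y"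
  shows "card (components I) \<le> card (components J)"
proof -
  let ?f = "\<lambda>A. {w \<in> verts G. \<exists>u\<in>A. joined I u w}"
  have "component I v = ?f (component J v)" if "v \<in> verts G" for v
    using that assms by (auto simp: component_def intro: joined_trans)
  then have "components I = ?f ` components J" by (auto simp: components_def image_image)
  then show ?thesis using finite_verts by (simp add: card_image_le components_def)
qed

lemma component_eq_iff:
  assumes "v \<in> verts G"
  shows "component I u = component I v \<longleftrightarrow> joined I u v"
proof
  assume "component I u = component I v"
  moreover have "v \<in> component I v" using assms by (simp add: component_def)
  ultimately have "v \<in> component I u" by simp
  then show "joined I u v" by (simp add: component_def)
next
  assume "joined I u v"
  then show "component I u = component I v"
    by (auto simp: component_def intro: joined_trans joined_sym)
qed

text \<open>A walk can be shortened until it crosses the new edge at most once, in one of the two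
  directions.\<close>

lemma joined_insert:
  assumes "ends G e = {u, v}"
  shows "joined (insert e I) x y \<longleftrightarrow>
    joined I x y \<or> joined I x u \<and> joined I v y \<or> joined I x v \<and> joined I u y"
    (is "_ \<longleftrightarrow> ?R y")
proof
  assume "joined (insert e I) x y"
  then show "?R y"
  proof (induction rule: rtranclp_induct)
    case (step y z)
    from step.hyps(2) consider "adjacent I y z" | "y = u" "z = v" | "y = v" "z = u"
      using assms by (auto simp: adjacent_def doubleton_eq_iff)
    then show ?case
    proof cases
      case 1
      then have "joined I y z" by simp
      then show ?thesis using step.IH joined_trans by blast
    next
      case 2
      then show ?thesis using step.IH joined_sym joined_trans by blast
    next
      case 3
      then show ?thesis using step.IH joined_sym joined_trans by blast
    qed
  qed simp
next
  assume R: "?R y"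
  have "adjacent (insert e I) u v" "adjacent (insert e I) v u"
    using assms by (auto simp: adjacent_def)
  then have uv: "joined (insert e I) u v" "joined (insert e I) v u" by auto
  have mono: "joined I a b \<Longrightarrow> joined (insert e I) a b" for a b
    by (rule joined_mono[rotated]) auto
  from R show "joined (insert e I) x y"
    using uv mono joined_trans by meson
qed

text \<open>The new edge merges the two distinct components of its ends and leaves the others
  unchanged.\<close>

lemma card_components_insert:
  assumes e: "ends G e = {u, v}" and uv: "u \<in> verts G" "v \<in> verts G" "\<not> joined I u v"
  shows "card (components I) = Suc (card (components (insert e I)))"
proof -
  let ?c = "component I" and ?d = "component (insert e I)"
  let ?cs = "components I - {?c u, ?c v}"
  have d1: "?d x = ?c u \<union> ?c v" if "joined I x u \<or> joined I x v" for x
    using that unfolding component_def joined_insert[OF e]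
    by (auto intro: joined_trans joined_sym)
  have d2: "?d x = ?c x" if "\<not> joined I x u" "\<not> joined I x v" for x
    using that unfolding component_def joined_insert[OF e] by auto
  have "components (insert e I) = insert (?c u \<union> ?c v) ?cs"
  proof (intro equalityI subsetI)
    fix A assume "A \<in> components (insert e I)"
    then obtain x where x: "x \<in> verts G" "A = ?d x" by (auto simp: components_def)
    show "A \<in> insert (?c u \<union> ?c v) ?cs"
    proof (cases "joined I x u \<or> joined I x v")
      case True
      then show ?thesis using d1 x by simp
    next
      case False
      then have "A = ?c x" "?c x \<noteq> ?c u" "?c x \<noteq> ?c v" using d2 x uv component_eq_iff by auto
      then show ?thesis using x by (auto simp: components_def)
    qed
  next
    fix A assume "A \<in> insert (?c u \<union> ?c v) ?cs"
    then consider "A = ?c u \<union> ?c v" | x where "x \<in> verts G" "A = ?c x" "?c x \<noteq> ?c u" "?c x \<noteq> ?c v"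
      by (auto simp: components_def)
    then show "A \<in> components (insert e I)"
    proof cases
      case 1
      then have "A = ?d u" using d1[of u] by simp
      then show ?thesis using uv by (simp add: components_def)
    next
      case 2
      then have "A = ?d x" using d2[of x] uv component_eq_iff by simp
      then show ?thesis using 2 by (simp add: components_def)
    qed
  qed
  moreover have "?c u \<union> ?c v \<notin> ?cs"
  proof
    assume "?c u \<union> ?c v \<in> ?cs"
    then obtain x where x: "?c u \<union> ?c v = ?c x" "?c x \<noteq> ?c u" by (auto simp: components_def)
    have "u \<in> ?c u" using uv by (simp add: component_def)
    then have "u \<in> ?c x" using x by blast
    then have "joined I x u" by (simp add: component_def)
    then show False using x(2) component_eq_iff[OF uv(1)] by simp
  qed
  moreover have fin: "finite (components I)" using finite_verts by (simp add: components_def)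
  ultimately have "card (components (insert e I)) = Suc (card ?cs)" by simp
  moreover have "{?c u, ?c v} \<subseteq> components I" using uv by (auto simp: components_def)
  then have "card (components I) = card ?cs + card {?c u, ?c v}"
    using fin by (metis card_Diff_subset card_mono finite.emptyI finite.insertI le_add_diff_inverse2)
  moreover have "?c u \<noteq> ?c v" using component_eq_iff uv by simp
  ultimately show ?thesis by simp
qed

lemma obtain_ends:
  assumes "e \<in> edges G"
  obtains u v where "ends G e = {u, v}" "u \<in> verts G" "v \<in> verts G"
proof -
  have "\<exists>u v. ends G e = {u, v}"
    using card_ends[OF assms] by (auto simp: card_1_singleton_iff card_2_iff)
  then show thesis using that ends_subset[OF assms] by auto
qed

section \<open>Paths and cycles\<close>

lemma joined_obtain_path:
  assumes "joined I u v" "u \<in> verts G" "I \<subseteq> edges G"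
  obtains vs es where "vs \<noteq> []" "hd vs = u" "last vs = v" "distinct vs" "set vs \<subseteq> verts G"
    "length vs = Suc (length es)" "set es \<subseteq> I"
    "\<And>i. i < length es \<Longrightarrow> ends G (es ! i) = {vs ! i, vs ! Suc i}"
proof -
  have "\<exists>vs es. vs \<noteq> [] \<and> hd vs = u \<and> last vs = v \<and> distinct vs \<and> set vs \<subseteq> verts G \<and>
      length vs = Suc (length es) \<and> set es \<subseteq> I \<and>
      (\<forall>i<length es. ends G (es ! i) = {vs ! i, vs ! Suc i})"
    using assms(1)
  proof (induction rule: rtranclp_induct)
    case base
    show ?case using assms(2) by (intro exI[of _ "[u]"] exI[of _ "[]"]) simp
  next
    case (step y z)
    then obtain vs es where p: "vs \<noteq> []" "hd vs = u" "last vs = y" "distinct vs" "set vs \<subseteq> verts G"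
        "length vs = Suc (length es)" "set es \<subseteq> I"
        "\<forall>i<length es. ends G (es ! i) = {vs ! i, vs ! Suc i}" by blast
    from step obtain e where e: "e \<in> I" "ends G e = {y, z}" by (auto simp: adjacent_def)
    have z: "z \<in> verts G" using e assms(3) ends_subset[of e] by auto
    show ?case
    proof (cases "z \<in> set vs")
      \<comment> \<open>The walk has returned to a visited vertex: cut the path back to it. This
        includes a loop at \<open>y\<close>.\<close>
      case True
      then obtain k where k: "k < length vs" "z = vs ! k" by (auto simp: in_set_conv_nth)
      have "last (take (Suc k) vs) = z" using k by (simp add: take_Suc_conv_app_nth)
      moreover have "set (take (Suc k) vs) \<subseteq> verts G" "set (take k es) \<subseteq> I"
        using p set_take_subset by fastforce+
      ultimately show ?thesis
        using p k by (intro exI[of _ "take (Suc k) vs"] exI[of _ "take k es"]) (auto simp: hd_take)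
    next
      case False
      have y: "y = vs ! length es" using p by (simp add: last_conv_nth)
      have "ends G ((es @ [e]) ! i) = {(vs @ [z]) ! i, (vs @ [z]) ! Suc i}" if "i < length (es @ [e])" for i
      proof (cases "i < length es")
        case True
        then show ?thesis using p by (simp add: nth_append)
      next
        case False
        then have "i = length es" using that by simp
        then show ?thesis using p(6) e y by (simp add: nth_append)
      qed
      then show ?thesis using p e z False by (intro exI[of _ "vs @ [z]"] exI[of _ "es @ [e]"]) auto
    qed
  qed
  then show thesis using that by blast
qed

text \<open>Close a path between the ends of \<open>e\<close> by \<open>e\<close>. For a loop the
  path is a single vertex and the cycle has length 1; for parallel edges it has length 2.\<close>

lemma graph_cycle_if_joined:
  assumes "joined I u v" "I \<subseteq> edges G" "e \<in> edges G - I" "ends G e = {u, v}"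
  shows "\<exists>vs es. graph_cycle G vs es \<and> set es \<subseteq> insert e I"
proof -
  have "u \<in> verts G" using assms ends_subset[of e] by auto
  then obtain vs es where p: "vs \<noteq> []" "hd vs = u" "last vs = v" "distinct vs" "set vs \<subseteq> verts G"
    "length vs = Suc (length es)" "set es \<subseteq> I"
    and nth: "\<And>i. i < length es \<Longrightarrow> ends G (es ! i) = {vs ! i, vs ! Suc i}"
    using joined_obtain_path[OF assms(1) _ assms(2)] by metis
  have "distinct es"
    unfolding distinct_conv_nth
  proof (intro allI impI notI)
    fix i j assume ij: "i < length es" "j < length es" "i \<noteq> j" "es ! i = es ! j"
    then have "{vs ! i, vs ! Suc i} = {vs ! j, vs ! Suc j}" using nth by metis
    then show False using ij p(4,6) by (auto simp: doubleton_eq_iff nth_eq_iff_index_eq)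
  qed
  moreover have "ends G ((es @ [e]) ! i) = {vs ! i, vs ! (Suc i mod length vs)}" if "i < length vs" for i
  proof (cases "i < length es")
    case True
    then show ?thesis using nth p(6) by (simp add: nth_append)
  next
    case False
    then have i: "i = length es" using that p(6) by simp
    have "vs ! 0 = u" "vs ! length es = v" using p(1,2,3,6) by (simp_all add: hd_conv_nth last_conv_nth)
    then show ?thesis using i p(6) assms(4) by (auto simp: nth_append)
  qed
  ultimately have "graph_cycle G vs (es @ [e])"
    using p assms(2,3) by (auto simp: graph_cycle_def)
  then show ?thesis using p(7) by (intro exI[of _ vs] exI[of _ "es @ [e]"]) auto
qed

lemma graph_cycle_joined:
  assumes cyc: "graph_cycle G vs es" and i: "i < length vs" and I: "set es - {es ! i} \<subseteq> I"
    and "x \<in> set vs" "y \<in> set vs"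
  shows "joined I x y"
proof -
  let ?n = "length vs"
  have c: "length es = ?n" "distinct es" "\<And>j. j < ?n \<Longrightarrow> ends G (es ! j) = {vs ! j, vs ! (Suc j mod ?n)}"
    using cyc by (auto simp: graph_cycle_def)
  have n: "0 < ?n" using i by auto
  \<comment> \<open>Start just behind the removed edge and go once around; \<open>i\<close> itself
    would be reached only after all other indices.\<close>
  have chain: "joined I (vs ! (Suc i mod ?n)) (vs ! ((Suc i + k) mod ?n))" if "k < ?n" for k
    using that
  proof (induction k)
    case (Suc k)
    let ?m = "(Suc i + k) mod ?n"
    have m: "?m < ?n" using n by simp
    have "?m \<noteq> i"
    proof (cases "Suc i + k < ?n")
      case False
      then have "?m = Suc i + k - ?n" using i Suc.prems by (simp add: le_mod_geq)
      then show ?thesis using False Suc.prems by simp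
    qed simp
    then have "es ! ?m \<in> I" using I c(1,2) m i by (auto simp: nth_eq_iff_index_eq)
    moreover have "Suc ?m mod ?n = (Suc i + Suc k) mod ?n" by (simp add: mod_Suc_eq)
    ultimately have "adjacent I (vs ! ?m) (vs ! ((Suc i + Suc k) mod ?n))"
      using c(3)[OF m] by (auto simp: adjacent_def)
    moreover have "joined I (vs ! (Suc i mod ?n)) (vs ! ?m)" using Suc by simp
    ultimately show ?case by simp
  qed simp
  have from_start: "joined I (vs ! (Suc i mod ?n)) z" if z: "z \<in> set vs" for z
  proof -
    obtain j where j: "j < ?n" "z = vs ! j" using z by (auto simp: in_set_conv_nth)
    \<comment> \<open>The cyclic distance from \<open>Suc i\<close> to \<open>j\<close>.\<close>
    let ?k = "(j + (?n - Suc i)) mod ?n"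
    have "(Suc i + ?k) mod ?n = (Suc i + (j + (?n - Suc i))) mod ?n" by (rule mod_add_right_eq)
    also have "Suc i + (j + (?n - Suc i)) = j + ?n" using i by simp
    finally have "(Suc i + ?k) mod ?n = j" using j by simp
    then show ?thesis using chain[of ?k] n j by simp
  qed
  show ?thesis
    by (rule joined_trans[OF joined_sym[OF from_start[OF assms(4)]] from_start[OF assms(5)]])
qed

section \<open>Independence and rank in cycle matroids\<close>

lemma ground_cycle_matroid [simp]: "ground (cycle_matroid G) = edges G"
  by (simp add: cycle_matroid_def)

lemma indep_cycle_matroid:
  "I \<in> indep (cycle_matroid G) \<longleftrightarrow> I \<subseteq> edges G \<and> \<not> (\<exists>vs es. graph_cycle G vs es \<and> set es \<subseteq> I)"
  by (simp add: cycle_matroid_def)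

text \<open>A new cycle must use \<open>e\<close>, and its remaining edges join the ends of
  \<open>e\<close> within \<open>I\<close>; conversely a path in \<open>I\<close> between these ends
  closes to a cycle.\<close>

lemma indep_insert_iff:
  assumes I: "I \<in> indep (cycle_matroid G)" and e: "e \<in> edges G - I" "ends G e = {u, v}"
  shows "insert e I \<in> indep (cycle_matroid G) \<longleftrightarrow> \<not> joined I u v"
proof
  assume "insert e I \<in> indep (cycle_matroid G)"
  then show "\<not> joined I u v"
    using graph_cycle_if_joined[OF _ _ e] I unfolding indep_cycle_matroid by blast
next
  assume nc: "\<not> joined I u v"
  have "\<not> (graph_cycle G vs es \<and> set es \<subseteq> insert e I)" for vs es
  proof
    assume c: "graph_cycle G vs es \<and> set es \<subseteq> insert e I"
    then have "e \<in> set es" using I unfolding indep_cycle_matroid by blast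
    then obtain i where i: "i < length es" "es ! i = e" by (auto simp: in_set_conv_nth)
    have len: "length es = length vs" "ends G (es ! i) = {vs ! i, vs ! (Suc i mod length vs)}"
      using c i by (auto simp: graph_cycle_def)
    have "Suc i mod length vs < length vs" using i len by (intro mod_less_divisor) auto
    then have "{u, v} \<subseteq> set vs" using i len e(2) by auto
    then have "joined I u v" using graph_cycle_joined[of vs es i I u v] c i len by auto
    then show False using nc by simp
  qed
  then show "insert e I \<in> indep (cycle_matroid G)"
    using I e unfolding indep_cycle_matroid by auto
qed

text \<open>Without edges every vertex is its own component, and each edge added to a forest merges
  two components.\<close>

lemma card_components_forest:
  assumes "I \<in> indep (cycle_matroid G)"
  shows "card I + card (components I) = card (verts G)"
proof -
  have "finite I" using assms finite_edges finite_subset unfolding indep_cycle_matroid by blast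
  then show ?thesis using assms
  proof (induction I rule: finite_induct)
    case empty
    have "joined {} x y \<longleftrightarrow> x = y" for x y
      by (auto elim: rtranclp.cases simp: adjacent_def)
    then have "component {} v = {v}" if "v \<in> verts G" for v using that by (auto simp: component_def)
    then have "components {} = (\<lambda>v. {v}) ` verts G" by (auto simp: components_def)
    then show ?case by (simp add: card_image)
  next
    case (insert e I)
    have I: "I \<in> indep (cycle_matroid G)" "e \<in> edges G - I"
      using insert.prems insert.hyps unfolding indep_cycle_matroid by auto
    then obtain u v where uv: "ends G e = {u, v}" "u \<in> verts G" "v \<in> verts G"
      using obtain_ends[of e] by blast
    then have "\<not> joined I u v" using indep_insert_iff[OF I uv(1)] insert.prems by simp
    then show ?case using card_components_insert[OF uv] insert.IH[OF I(1)] insert.hyps by simp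
  qed
qed

text \<open>For augmentation: if no edge of J extends I, then all edges of J have their ends joined
  by I, so I has at most as many components as J, and the forest formula gives that J is no larger
  than I.\<close>

lemma matroid_cycle_matroid: "matroid (cycle_matroid G)"
proof
  show "finite (ground (cycle_matroid G))" using finite_edges by simp
  show "I \<subseteq> ground (cycle_matroid G)" if "I \<in> indep (cycle_matroid G)" for I
    using that by (simp add: indep_cycle_matroid)
  show "{} \<in> indep (cycle_matroid G)" by (auto simp: indep_cycle_matroid graph_cycle_def)
  show "J \<in> indep (cycle_matroid G)" if "I \<in> indep (cycle_matroid G)" "J \<subseteq> I" for I J
    using that unfolding indep_cycle_matroid by blast
  fix I J assume IJ: "I \<in> indep (cycle_matroid G)" "J \<in> indep (cycle_matroid G)" "card I < card J"
  show "\<exists>x\<in>J - I. insert x I \<in> indep (cycle_matroid G)"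
  proof (rule ccontr)
    assume none: "\<not> (\<exists>x\<in>J - I. insert x I \<in> indep (cycle_matroid G))"
    have edges: "joined I u v" if e: "e \<in> J" "ends G e = {u, v}" for e u v
    proof (cases "e \<in> I")
      case True
      then show ?thesis using e(2) by (rule joined_ends)
    next
      case False
      then have "e \<in> edges G - I" using e IJ(2) unfolding indep_cycle_matroid by blast
      then show ?thesis using indep_insert_iff[OF IJ(1) _ e(2)] none e(1) by blast
    qed
    have "card (components I) \<le> card (components J)"
      by (rule card_components_antimono, erule joined_if_edges_joined[rotated], rule edges)
    then show False
      using card_components_forest[OF IJ(1)] card_components_forest[OF IJ(2)] IJ(3) by simp
  qed
qed

sublocale cycle: matroid "cycle_matroid G"
  by (rule matroid_cycle_matroid)

text \<open>A largest forest in \<open>X\<close> has the same components as \<open>X\<close>, since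
  every other edge of \<open>X\<close> would extend it if its ends were not joined.\<close>

lemma rank_cycle_matroid:
  assumes "X \<subseteq> edges G"
  shows "rank_of (cycle_matroid G) X + card (components X) = card (verts G)"
proof -
  obtain I where I: "I \<in> indep (cycle_matroid G)" "I \<subseteq> X" "card I = rank_of (cycle_matroid G) X"
    by (rule cycle.obtain_rank_witness)
  have edges: "joined I u v" if e: "e \<in> X" "ends G e = {u, v}" for e u v
  proof (cases "e \<in> I")
    case True
    then show ?thesis using e(2) by (rule joined_ends)
  next
    case False
    then have "card (insert e I) = Suc (card I)" using cycle.finite_indep[OF I(1)] by simp
    then have "insert e I \<notin> indep (cycle_matroid G)"
      using cycle.card_indep_le_rank[of "insert e I" X] I e by auto
    then show ?thesis using indep_insert_iff[OF I(1) _ e(2)] False e assms by blast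
  qed
  have "card (components I) \<le> card (components X)"
    by (rule card_components_antimono, erule joined_if_edges_joined[rotated], rule edges)
  moreover have "card (components X) \<le> card (components I)"
    using joined_mono[OF I(2)] by (intro card_components_antimono)
  ultimately show ?thesis using card_components_forest[OF I(1)] I(3) by simp
qed

text \<open>A Hamiltonian cycle minus any edge still joins all vertices, so its rank is one less
  than their number, which is its size: it is independent. No edge set has larger rank, since there
  is at least one component.\<close>

lemma hamiltonian_imp_spanning_circuit:
  assumes "hamiltonian G"
  shows "\<exists>C. spanning_circuit (cycle_matroid G) C"
proof -
  let ?M = "cycle_matroid G"
  obtain vs es where cyc: "graph_cycle G vs es" and vs: "set vs = verts G"
    using assms by (auto simp: hamiltonian_def)
  have c: "vs \<noteq> []" "length es = length vs" "distinct vs" "distinct es" "set es \<subseteq> edges G"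
    using cyc by (auto simp: graph_cycle_def)
  have card: "card (set es) = card (verts G)" using c vs by (metis distinct_card)
  have del: "set es - {e} \<in> indep ?M" if e: "e \<in> set es" for e
  proof -
    let ?X = "set es - {e}"
    obtain i where i: "i < length vs" "es ! i = e" using e c by (auto simp: in_set_conv_nth)
    have "component ?X v = verts G" if "v \<in> verts G" for v
      using graph_cycle_joined[OF cyc i(1), of ?X v] i(2) vs that by (auto simp: component_def)
    then have "components ?X = (\<lambda>v. verts G) ` verts G" by (simp add: components_def)
    also have "\<dots> = {verts G}" using c(1) vs[symmetric] by (cases vs) auto
    finally have "components ?X = {verts G}" .
    moreover have "?X \<subseteq> edges G" using c(5) by blast
    ultimately have "Suc (rank_of ?M ?X) = card (verts G)" using rank_cycle_matroid[of ?X] by simp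
    then have "rank_of ?M ?X = card ?X" using card e by (simp add: card_Diff_singleton)
    then show ?thesis using cycle.indep_iff_rank[of ?X] by simp
  qed
  have circ: "circuit ?M (set es)"
    unfolding circuit_def
  proof (intro conjI allI impI)
    show "set es \<subseteq> ground ?M" using c by simp
    show "set es \<notin> indep ?M" using cyc unfolding indep_cycle_matroid by blast
    fix D assume "D \<subset> set es"
    then obtain e where "e \<in> set es" "D \<subseteq> set es - {e}" by blast
    then show "D \<in> indep ?M" using del cycle.indep_subset by blast
  qed
  have "components (edges G) \<noteq> {}" using c(1) vs by (auto simp: components_def)
  then have "0 < card (components (edges G))" using finite_verts by (simp add: card_gt_0_iff components_def)
  then have "rank_of ?M (edges G) < card (verts G)" using rank_cycle_matroid[of "edges G"] by simp
  then have "rank_of ?M (set es) = matroid_rank ?M"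
    using cycle.circuit_rank(1)[OF circ] card cycle.rank_mono[OF c(5)] by (simp add: matroid_rank_def)
  then show ?thesis using circ by (auto simp: spanning_circuit_def)
qed

text \<open>A circuit is the edge set of a cycle. If the cycle missed a vertex, a non-loop edge
  there could be added to the circuit minus one of its edges, giving an independent set larger than
  the rank.\<close>

lemma spanning_circuit_imp_hamiltonian:
  assumes "no_trivial_component G" "spanning_circuit (cycle_matroid G) C"
  shows "hamiltonian G"
proof -
  let ?M = "cycle_matroid G"
  have circ: "circuit ?M C" and span: "rank_of ?M C = matroid_rank ?M"
    using assms(2) by (auto simp: spanning_circuit_def)
  have C: "C \<subseteq> edges G" "C \<notin> indep ?M" "\<And>D. D \<subset> C \<Longrightarrow> D \<in> indep ?M"
    using circ by (auto simp: circuit_def)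
  then obtain vs es where cyc: "graph_cycle G vs es" and sub: "set es \<subseteq> C"
    unfolding indep_cycle_matroid by blast
  have "set es \<notin> indep ?M" using cyc unfolding indep_cycle_matroid by blast
  then have es: "set es = C" using sub C(3) by blast
  have c: "vs \<noteq> []" "length es = length vs" "set vs \<subseteq> verts G"
    and nth: "\<And>i. i < length vs \<Longrightarrow> ends G (es ! i) = {vs ! i, vs ! (Suc i mod length vs)}"
    using cyc by (auto simp: graph_cycle_def)
  have ends_C: "ends G f \<subseteq> set vs" if "f \<in> C" for f
  proof -
    obtain i where i: "i < length vs" "f = es ! i" 
      using \<open>f \<in> C\<close> c(2) unfolding es[symmetric] by (auto simp: in_set_conv_nth)
    have "Suc i mod length vs < length vs" using i by (intro mod_less_divisor) auto
    then show ?thesis using nth[OF i(1)] i by simp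
  qed
  have "verts G \<subseteq> set vs"
  proof (rule ccontr)
    assume "\<not> verts G \<subseteq> set vs"
    then obtain z where z: "z \<in> verts G" "z \<notin> set vs" by blast
    \<comment> \<open>The cycle has a vertex, and it differs from \<open>z\<close>; this leaves the
      alternative that \<open>z\<close> has a non-loop edge.\<close>
    have "verts G \<noteq> {z}" using c(1,3) z by (cases vs) auto
    then obtain e where e: "e \<in> edges G" "z \<in> ends G e" "card (ends G e) = 2"
      using assms(1) z by (auto simp: no_trivial_component_def)
    then obtain y where y: "ends G e = {z, y}" "y \<noteq> z"
      unfolding card_2_iff by (metis doubleton_eq_iff insertE singletonD)
    define I where "I = C - {es ! 0}"
    have es0: "es ! 0 \<in> C" unfolding es[symmetric] using c by simp
    have I: "I \<in> indep ?M" using C(3)[of I] es0 by (auto simp: I_def)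
    have eI: "e \<in> edges G - I" using ends_C[of e] e(1,2) z by (auto simp: I_def)
    \<comment> \<open>The vertex \<open>z\<close> meets no edge of \<open>C\<close>, so
      \<open>I\<close> joins it to itself only.\<close>
    have "\<not> joined I z y"
    proof
      assume "joined I z y"
      then show False
      proof (cases rule: converse_rtranclpE)
        case base
        then show ?thesis using y by simp
      next
        case (step w)
        then obtain f where "f \<in> C" "ends G f = {z, w}" by (auto simp: adjacent_def I_def)
        then show ?thesis using ends_C[of f] z by simp
      qed
    qed
    then have "insert e I \<in> indep ?M" using indep_insert_iff[OF I eI y(1)] by simp
    then have "card (insert e I) \<le> matroid_rank ?M"
      unfolding matroid_rank_def using I e(1)
      by (intro cycle.card_indep_le_rank) (auto simp: indep_cycle_matroid)
    moreover have "card (insert e I) = card C"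
      using eI cycle.finite_indep[OF I] card_Suc_Diff1[OF finite_subset[OF C(1) finite_edges] es0]
      by (simp add: I_def del: card_Diff_insert)
    ultimately show False using cycle.circuit_rank(1)[OF circ] span by simp
  qed
  then show ?thesis using cyc c(3) unfolding hamiltonian_def by blast
qed

lemma hamiltonian_iff_spanning_circuit:
  assumes "no_trivial_component G"
  shows "hamiltonian G \<longleftrightarrow> (\<exists>C. spanning_circuit (cycle_matroid G) C)"
  using hamiltonian_imp_spanning_circuit spanning_circuit_imp_hamiltonian[OF assms] by blast

end

theorem corollary5p3:
  fixes M :: "'a indep_system" and N :: "'b indep_system"
    and G :: "('u, 'e) pre_multigraph" and H :: "('v, 'f) pre_multigraph"
  shows
    "(matroid M \<and> matroid N \<and> catenary_data M = catenary_data N \<longrightarrow>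
        (\<forall>s. card {C. cocircuit M C \<and> card C = s} = card {C. cocircuit N C \<and> card C = s}) \<and>
        (\<forall>s. card {C. circuit M C \<and> card C = s} = card {C. circuit N C \<and> card C = s}) \<and>
        (\<forall>s j. card {X. cyclic_set M X \<and> card X = s \<and> rank_of M X = j} =
               card {X. cyclic_set N X \<and> card X = s \<and> rank_of N X = j}) \<and>
        ((\<exists>C. spanning_circuit M C) \<longleftrightarrow> (\<exists>C. spanning_circuit N C))) \<and>
     (multigraph G \<and> multigraph H \<and> no_trivial_component G \<and> no_trivial_component H \<and>
        (G_invariant (cycle_matroid G) :: nat list \<Rightarrow>\<^sub>0 'k::field_char_0) =
          G_invariant (cycle_matroid H) \<longrightarrow>
        (hamiltonian G \<longleftrightarrow> hamiltonian H))"
proof (intro conjI impI)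
  assume "matroid M \<and> matroid N \<and> catenary_data M = catenary_data N"
  then interpret equal_rank_sequences M N
    using rank_sequences_eq_if_catenary_data_eq
    by (auto simp: equal_rank_sequences_def equal_rank_sequences_axioms_def)
  show "\<forall>s. card {C. cocircuit M C \<and> card C = s} = card {C. cocircuit N C \<and> card C = s}"
    "\<forall>s. card {C. circuit M C \<and> card C = s} = card {C. circuit N C \<and> card C = s}"
    "\<forall>s j. card {X. cyclic_set M X \<and> card X = s \<and> rank_of M X = j} =
       card {X. cyclic_set N X \<and> card X = s \<and> rank_of N X = j}"
    "(\<exists>C. spanning_circuit M C) \<longleftrightarrow> (\<exists>C. spanning_circuit N C)"
    using card_cocircuits_eq card_circuits_eq card_cyclic_sets_eq spanning_circuit_eq by simp_all
next
  assume GH: "multigraph G \<and> multigraph H \<and> no_trivial_component G \<and> no_trivial_component H \<and>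
    (G_invariant (cycle_matroid G) :: nat list \<Rightarrow>\<^sub>0 'k) = G_invariant (cycle_matroid H)"
  interpret G: multigraph G using GH by simp
  interpret H: multigraph H using GH by simp
  interpret equal_rank_sequences "cycle_matroid G" "cycle_matroid H"
    using rank_sequences_eq_if_G_invariant_eq GH by unfold_locales blast
  show "hamiltonian G \<longleftrightarrow> hamiltonian H"
    using GH G.hamiltonian_iff_spanning_circuit H.hamiltonian_iff_spanning_circuit spanning_circuit_eq
    by simp
qed

end
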